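(* Let the finite group $G$ act on the set $\Omega$. Assume that: - $|\mathrm{Fix}_\Omega(g)|\in\{1,2\}$ for all $g\in G\setminus\{1\}$; - $|\mathrm{Fix}_\Omega(g)|=1$ for some $g\in G\setminus\{1\}$; - each orbit of $G$ on $\Omega$ has length at least $3$. Set $\Gamma=\{\gamma\in\Omega : \{\gamma\}=\mathrm{Fix}_\Omega(g)\text{ for some }g\in G\setminus\{1\}\}$ and for each $\gamma\in\Gamma$ let $$K_\gamma=\{g\in G_\gamma\setminus\{1\} : \mathrm{Fix}_{\Omega\setminus\{\gamma\}}(g)=\emptyset\}\cup\{1\}.$$ Fix $\gamma\in\Gamma$ and let $q=|K_\gamma|$. Then $\Gamma$ is an orbit of $G$, there is exactly one other nonregular orbit $\Delta$, and one of the following holds. (a) $G$ is $2$-transitive on $\Gamma$, $q\ge 3$, $|\Gamma|=q+1$, $|\Delta|=q(q-1)$, and if $\gamma'\in\Gamma\setminus\{\gamma\}$ then $|G_{\gamma\gamma'}|=\tfrac12(q-1)$ or $q-1$. (b) $G\cong\mathrm{Alt}(5)$, $G_\gamma\cong\mathrm{Sym}(3)$, $K_\gamma\cong C_3$ (cyclic of order $3$), $q=3$, $|\Gamma|=10$ and $|\Delta|=12$.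
   Context: $\mathrm{Fix}_\Omega(g)$ is the set of points of $\Omega$ fixed by $g$. $G_\gamma$ is the stabilizer of $\gamma$ and $G_{\gamma\gamma'}=G_\gamma\cap G_{\gamma'}$. An orbit is regular if point stabilizers on it are trivial, and nonregular otherwise. *)

theory Defs
  imports Complex_Main "HOL-Algebra.Group_Action" "HOL-Algebra.Sym_Groups" "HOL-Algebra.Elementary_Groups"
begin

definition nonregular_orbits ::
  "('g, 'm) monoid_scheme \<Rightarrow> 'x set \<Rightarrow> ('g \<Rightarrow> 'x \<Rightarrow> 'x) \<Rightarrow> 'x set set"
where
  "nonregular_orbits G \<Omega> \<phi> =
     {Orb \<in> orbits G \<Omega> \<phi>. \<not> (\<forall>x\<in>Orb. stabilizer G \<phi> x = {\<one>\<^bsub>G\<^esub>})}"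

definition unique_fixed_points ::
  "('g, 'm) monoid_scheme \<Rightarrow> 'x set \<Rightarrow> ('g \<Rightarrow> 'x \<Rightarrow> 'x) \<Rightarrow> 'x set"
where
  "unique_fixed_points G \<Omega> \<phi> =
     {\<gamma> \<in> \<Omega>. \<exists>g \<in> carrier G - {\<one>\<^bsub>G\<^esub>}. {\<gamma>} = invariants \<Omega> \<phi> g}"

text \<open>The set \<open>K\<^sub>\<gamma>\<close>. The set \<open>\<Omega> - {\<gamma>}\<close> is preserved by every element of the
  stabilizer of \<open>\<gamma>\<close>, so \<open>invariants (\<Omega> - {\<gamma>}) \<phi> g\<close> is its fixed point set there.\<close>

definition one_point_kernel ::
  "('g, 'm) monoid_scheme \<Rightarrow> 'x set \<Rightarrow> ('g \<Rightarrow> 'x \<Rightarrow> 'x) \<Rightarrow> 'x \<Rightarrow> 'g set"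
where
  "one_point_kernel G \<Omega> \<phi> \<gamma> =
     {g \<in> stabilizer G \<phi> \<gamma> - {\<one>\<^bsub>G\<^esub>}. invariants (\<Omega> - {\<gamma>}) \<phi> g = {}} \<union> {\<one>\<^bsub>G\<^esub>}"

definition two_transitive_on ::
  "('g, 'm) monoid_scheme \<Rightarrow> ('g \<Rightarrow> 'x \<Rightarrow> 'x) \<Rightarrow> 'x set \<Rightarrow> bool"
where
  "two_transitive_on G \<phi> S \<longleftrightarrow>
     (\<forall>a\<in>S. \<forall>b\<in>S. \<forall>c\<in>S. \<forall>d\<in>S. a \<noteq> b \<longrightarrow> c \<noteq> d \<longrightarrow>
        (\<exists>g\<in>carrier G. \<phi> g a = c \<and> \<phi> g b = d))"

end

theory Submission
  imports Defs "HOL-Algebra.Multiplicative_Group" "HOL-Algebra.Sylow"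
begin

text \<open>Let every nontrivial element spread total weight 2 over its fixed points. A nonregular orbit
  inside \<open>\<Gamma>\<close> then carries weight at least \<open>|G|\<close> and any other one weight at least \<open>|G|/2\<close>, while
  the total is \<open>2|G| - 2\<close>. This leaves \<open>\<Gamma>\<close> and one further orbit \<open>\<Delta>\<close>, with
  \<open>|\<Delta>| = |\<Gamma>|(q - 2) + 2\<close>.

  For \<open>\<gamma> \<in> \<Gamma>\<close>, the elements of \<open>G\<^sub>\<gamma>\<close> outside \<open>K\<^sub>\<gamma>\<close> have their second fixed point in a single
  \<open>G\<^sub>\<gamma>\<close>-orbit of length \<open>q\<close>, whose point stabilizers have order \<open>f\<close> dividing \<open>q - 1\<close>. Since \<open>G\<^sub>\<gamma>\<close> acts
  semiregularly on the remaining points of \<open>\<Gamma>\<close>, \<open>|\<Gamma>|\<close> is determined modulo \<open>fq\<close>, and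
  \<open>|\<Delta>|\<close> dividing \<open>|G|\<close> leaves only the two cases. No use is made of Frobenius' theorem.\<close>

section \<open>Recognising small groups\<close>

text \<open>Giving each nontrivial element total weight 2 makes the grand total independent of how
  many of them have one fixed point and how many have two.

  The number q is recovered by counting. No nontrivial element fixes three points, so in a point
  stabilizer S the nontrivial elements with a second fixed point in a given suborbit O number
  exactly |S| - |O|. Once all second fixed points are known to lie in one suborbit, the remaining
  elements form \<open>Ker x\<close>, and q = |O|.

  The obstacle is that this suborbit may lie inside or outside \<Gamma>. Inside, |\<Gamma>| = 1 + q
  + mfq; outside, |\<Gamma>| = 1 + mfq, which coprimality refutes. With m = 0 the suborbit fills the
  rest of \<Gamma>, which is 2-transitivity. The only solution with m > 0 is m = 1, f = 2, q = 3,
  with |G| = 10 * 6 = 60. Then Alt(5) has to be recognised from numbers alone: 15 involutions,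
  centralizers of order at most 4, and no element of order 4.\<close>

text \<open>Transports an action along an enumeration of \<open>S\<close>. The laws are required on
  \<open>S\<close> only, so that both point actions and the conjugation of subsets qualify.\<close>

lemma (in group) embed_into_sym_group:
  assumes "finite S"
    and closed: "\<And>g s. g \<in> carrier G \<Longrightarrow> s \<in> S \<Longrightarrow> a g s \<in> S"
    and one: "\<And>s. s \<in> S \<Longrightarrow> a \<one> s = s"
    and mult: "\<And>g h s. g \<in> carrier G \<Longrightarrow> h \<in> carrier G \<Longrightarrow> s \<in> S \<Longrightarrow> a (g \<otimes> h) s = a g (a h s)"
    and faithful: "\<And>g. g \<in> carrier G \<Longrightarrow> (\<And>s. s \<in> S \<Longrightarrow> a g s = s) \<Longrightarrow> g = \<one>"
  obtains f where "f \<in> hom G (sym_group (card S))" "inj_on f (carrier G)"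
proof -
  let ?N = "{1..card S}"
  obtain b where b: "bij_betw b ?N S"
    using finite_same_card_bij[of ?N S] \<open>finite S\<close> by auto
  define c where "c = inv_into ?N b"
  have bS: "b i \<in> S" if "i \<in> ?N" for i using b that by (auto simp: bij_betw_def)
  have cN: "c s \<in> ?N" if "s \<in> S" for s
    using b that unfolding c_def by (metis bij_betw_def inv_into_into)
  have bc: "b (c s) = s" if "s \<in> S" for s
    using b that unfolding c_def by (simp add: bij_betw_inv_into_right)
  have cb: "c (b i) = i" if "i \<in> ?N" for i
    using b that unfolding c_def by (simp add: bij_betw_inv_into_left)
  \<comment> \<open>Elements of \<open>sym_group n\<close> are total functions moving only {1..n},
    hence the identity outside.\<close>
  define f where "f g = (\<lambda>i. if i \<in> ?N then c (a g (b i)) else i)" for g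
  have fN: "f g i \<in> ?N" if "g \<in> carrier G" "i \<in> ?N" for g i
    using that unfolding f_def by (simp only: if_True cN closed bS)
  have f_mult: "f (g \<otimes> h) = f g \<circ> f h" if "g \<in> carrier G" "h \<in> carrier G" for g h
  proof
    fix i show "f (g \<otimes> h) i = (f g \<circ> f h) i"
    proof (cases "i \<in> ?N")
      case True
      then show ?thesis
        using cN[OF closed[OF that(2) bS[OF True]]] that bS[OF True]
        by (simp only: f_def o_apply if_True mult closed bc)
    qed (simp add: f_def del: atLeastAtMost_iff)
  qed
  have f_one: "f \<one> = id"
    by (rule ext) (simp add: f_def one bS cb del: atLeastAtMost_iff)
  have perm: "f g permutes ?N" if g: "g \<in> carrier G" for g
  proof (rule bij_imp_permutes)
    have "f (inv g) \<circ> f g = id" "f g \<circ> f (inv g) = id"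
      using f_mult[of "inv g" g] f_mult[of g "inv g"] g f_one by auto
    then show "bij_betw (f g) ?N ?N"
      by (intro bij_betw_byWitness[where f' = "f (inv g)"])
        (use fN g in \<open>auto simp: fun_eq_iff simp del: atLeastAtMost_iff\<close>)
  qed (simp add: f_def del: atLeastAtMost_iff)
  have "f \<in> hom G (sym_group (card S))"
    using perm f_mult by (auto simp: hom_def sym_group_def)
  moreover have "inj_on f (carrier G)"
  proof (rule inj_onI)
    fix g h assume gh: "g \<in> carrier G" "h \<in> carrier G" "f g = f h"
    have "f (inv h \<otimes> g) = id"
      using f_mult[of "inv h" g] f_mult[of "inv h" h] gh f_one by (metis inv_closed l_inv)
    have "a (inv h \<otimes> g) s = s" if s: "s \<in> S" for s
    proof -
      have "f (inv h \<otimes> g) (c s) = c s"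
        using \<open>f (inv h \<otimes> g) = id\<close> by simp
      then have "c (a (inv h \<otimes> g) (b (c s))) = c s"
        using cN[OF s] by (simp only: f_def if_True)
      then show ?thesis
        using s bc closed[of "inv h \<otimes> g" s] gh by (metis inv_closed m_closed)
    qed
    then have "inv h \<otimes> g = \<one>" by (intro faithful) (use gh in simp_all)
    then show "g = h" using gh by (metis inv_equality inv_inv inv_closed)
  qed
  ultimately show thesis using that by blast
qed

text \<open>If x lies outside H, then H and xH are disjoint and by size fill G. A square x x in xH
  would put x into H, so it lies in H.\<close>

lemma (in group) index_2_square_mem:
  assumes H: "subgroup H G" and fin: "finite (carrier G)" and card: "2 * card H = order G"
    and x: "x \<in> carrier G"
  shows "x \<otimes> x \<in> H"
proof (rule ccontr)
  assume no: "x \<otimes> x \<notin> H"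
  interpret H: subgroup H G by fact
  have xH: "x \<notin> H" using no by blast
  let ?C = "(\<lambda>h. x \<otimes> h) ` H"
  have disj: "H \<inter> ?C = {}"
  proof -
    have "x \<in> H" if "h \<in> H" "x \<otimes> h \<in> H" for h
      using that x H.m_closed[OF that(2) H.m_inv_closed[OF that(1)]]
      by (simp add: m_assoc)
    then show ?thesis using xH by auto
  qed
  have "card ?C = card H"
    by (rule card_image) (use x in \<open>auto simp: inj_on_def\<close>)
  moreover have "finite H" using fin H.subset finite_subset by blast
  ultimately have "card (H \<union> ?C) = order G"
    using card disj by (simp add: card_Un_disjoint)
  moreover have "H \<union> ?C \<subseteq> carrier G" using x by auto
  ultimately have "H \<union> ?C = carrier G" using fin by (simp add: card_subset_eq order_def)
  then obtain h where h: "h \<in> H" "x \<otimes> x = x \<otimes> h" using no x by blast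
  then have "x = h" using x by simp
  then show False using h xH by simp
qed

text \<open>The 3-cycles generate Alt(n), so H contains Alt(n), and both have n!/2 elements.\<close>

lemma index_2_subgroup_sym_group:
  assumes H: "subgroup H (sym_group n)" and card: "2 * card H = fact n" and n: "n \<ge> 2"
  shows "H = carrier (alt_group n)"
proof -
  interpret S: group "sym_group n" by (rule sym_group_is_group)
  interpret A: group "alt_group n" by (rule alt_group_is_group)
  let ?A = "carrier (alt_group n)"
  have alt: "alt_group n = sym_group n\<lparr>carrier := ?A\<rparr>" by (simp add: alt_group_def)
  have fin: "finite (carrier (sym_group n))"
    by (metis sym_group_card_carrier card_ge_0_finite fact_gt_zero)
  have finH: "finite H" using fin H finite_subset subgroup.subset by blast
  have "three_cycles n \<subseteq> H \<inter> ?A"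
  proof
    fix p assume p: "p \<in> three_cycles n"
    then obtain cs where cs: "p = cycle_of_list cs" "cycle cs" "length cs = 3" by auto
    have p': "p \<in> ?A" using p three_cycles_incl by blast
    then have pS: "p \<in> carrier (sym_group n)" using alt_group_is_subgroup subgroup.subset by blast
    obtain a b c where "cs = [a, b, c]" using cs(3) stupid_lemma by blast
    \<comment> \<open>A 3-cycle has order 3, so p is its own fourth power and thereby the square of
      \<open>p \<circ> p\<close>.\<close>
    then have "(p \<circ> p) \<circ> (p \<circ> p) = p"
      using cs(1,2) by (auto simp: fun_eq_iff transpose_def)
    moreover have "(p \<circ> p) \<circ> (p \<circ> p) \<in> H"
      using S.index_2_square_mem[OF H fin _ S.m_closed[OF pS pS]] card
      by (simp add: sym_group_mult order_def sym_group_card_carrier)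
    ultimately show "p \<in> H \<inter> ?A" using p' by simp
  qed
  moreover have "subgroup (H \<inter> ?A) (alt_group n)"
    using S.subgroup_incl[OF S.subgroups_Inter_pair[OF H alt_group_is_subgroup] alt_group_is_subgroup]
    by (simp flip: alt)
  ultimately have "generate (alt_group n) (three_cycles n) \<subseteq> H \<inter> ?A"
    by (rule A.generate_subgroup_incl)
  then have "?A \<subseteq> H" using alt_group_carrier_as_three_cycles by blast
  moreover have "card ?A = card H" using alt_group_card_carrier[OF n] card by simp
  ultimately show ?thesis using finH card_subset_eq by blast
qed

text \<open>Any x other than 1 has order p. The isomorphism is built as the exponent map into G and
  then inverted.\<close>

lemma (in group) prime_order_iso_integer_mod_group:
  assumes "prime (order G)"
  shows "G \<cong> integer_mod_group (order G)"
proof -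
  let ?p = "order G"
  have fin: "finite (carrier G)" using prime_gt_0_nat[OF assms] order_gt_0_iff_finite by simp
  have "card (carrier G) > 1" using prime_gt_1_nat[OF assms] by (simp add: order_def)
  then obtain x where x: "x \<in> carrier G" "x \<noteq> \<one>"
    using card_le_Suc0_iff_eq[OF fin] by (metis One_nat_def not_less)
  have ord: "ord x = ?p"
    using ord_dvd_group_order[OF x(1)] assms ord_eq_1[OF x(1)] x(2)
    unfolding prime_nat_iff by blast
  let ?f = "\<lambda>i::int. x [^] i"
  have eq: "?f i = ?f j \<longleftrightarrow> i mod int ?p = j mod int ?p" for i j
    using int_pow_eq[OF x(1), of i j] ord by (metis mod_eq_dvd_iff)
  have p0: "?p > 0" using prime_gt_0_nat[OF assms] .
  have car: "carrier (integer_mod_group ?p) = {0..<int ?p}"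
    using p0 by (simp add: carrier_integer_mod_group)
  have inj: "inj_on ?f {0..<int ?p}"
    by (auto simp: inj_on_def eq)
  have "?f ` {0..<int ?p} \<subseteq> carrier G" using x by auto
  moreover have "card (?f ` {0..<int ?p}) = card (carrier G)"
    using card_image[OF inj] by (simp add: order_def)
  ultimately have "?f ` {0..<int ?p} = carrier G" using fin card_subset_eq by blast
  moreover have "?f \<in> hom (integer_mod_group ?p) G"
    using x by (auto simp: hom_def car int_pow_mult[symmetric] eq)
  ultimately have "?f \<in> iso (integer_mod_group ?p) G"
    using inj by (simp add: iso_def bij_betw_def car)
  then show ?thesis
    using group.iso_sym[OF group_integer_mod_group] is_isoI by blast
qed


section \<open>Conjugation, centralizers and the recognition of Alt(5)\<close>

lemma (in group) centralizer_subgroup: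
  assumes t: "t \<in> carrier G"
  shows "subgroup {g \<in> carrier G. g \<otimes> t = t \<otimes> g} G"
proof (rule subgroupI)
  fix g assume "g \<in> {g \<in> carrier G. g \<otimes> t = t \<otimes> g}"
  then show "inv g \<in> {g \<in> carrier G. g \<otimes> t = t \<otimes> g}"
    using t by (metis (mono_tags, lifting) inv_closed inv_solve_left inv_solve_right m_assoc m_closed mem_Collect_eq)
next
  fix g h assume "g \<in> {g \<in> carrier G. g \<otimes> t = t \<otimes> g}" "h \<in> {g \<in> carrier G. g \<otimes> t = t \<otimes> g}"
  then show "g \<otimes> h \<in> {g \<in> carrier G. g \<otimes> t = t \<otimes> g}"
    using t by simp (metis m_assoc)
qed (use t in auto)

lemma (in group) conj_eq_self_iff:
  assumes "g \<in> carrier G" "t \<in> carrier G"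
  shows "g \<otimes> t \<otimes> inv g = t \<longleftrightarrow> g \<otimes> t = t \<otimes> g"
  using assms by (metis inv_solve_right' m_closed)

lemma (in group) conj_mult:
  assumes "g \<in> carrier G" "x \<in> carrier G" "y \<in> carrier G"
  shows "g \<otimes> (x \<otimes> y) \<otimes> inv g = (g \<otimes> x \<otimes> inv g) \<otimes> (g \<otimes> y \<otimes> inv g)"
proof -
  have "inv g \<otimes> (g \<otimes> (y \<otimes> inv g)) = y \<otimes> inv g"
    using assms by (metis inv_closed inv_solve_left m_closed)
  then show ?thesis using assms by (simp add: m_assoc)
qed

lemma (in group) conj_comp:
  assumes "g \<in> carrier G" "h \<in> carrier G" "x \<in> carrier G"
  shows "(g \<otimes> h) \<otimes> x \<otimes> inv (g \<otimes> h) = g \<otimes> (h \<otimes> x \<otimes> inv h) \<otimes> inv g"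
  using assms by (simp add: m_assoc inv_mult_group)

lemma (in group) orbit_conjugation_card:
  assumes t: "t \<in> carrier G"
  shows "card ((\<lambda>g. g \<otimes> t \<otimes> inv g) ` carrier G) * card {g \<in> carrier G. g \<otimes> t = t \<otimes> g} = order G"
proof -
  let ?\<psi> = "\<lambda>g. \<lambda>h \<in> carrier G. g \<otimes> h \<otimes> inv g"
  interpret A: group_action G "carrier G" ?\<psi> by (rule action_by_conjugation)
  have "orbit G ?\<psi> t = (\<lambda>g. g \<otimes> t \<otimes> inv g) ` carrier G"
    using t by (auto simp: orbit_def)
  moreover have "stabilizer G ?\<psi> t = {g \<in> carrier G. g \<otimes> t = t \<otimes> g}"
    using t by (simp add: stabilizer_def conj_eq_self_iff cong: conj_cong)
  ultimately show ?thesis using A.orbit_stabilizer_theorem[OF t] by simp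
qed

text \<open>The centralizers of the involutions are five Klein four-groups, which G permutes
  faithfully by conjugation; an index two subgroup of Sym(5) contains all 3-cycles,
  as they are squares.\<close>

lemma (in group) iso_alt_group_5:
  defines "I \<equiv> {x \<in> carrier G. x \<noteq> \<one> \<and> x \<otimes> x = \<one>}"
  assumes order: "order G = 60"
    and no4: "\<And>x. x \<in> carrier G \<Longrightarrow> (x \<otimes> x) \<otimes> (x \<otimes> x) = \<one> \<Longrightarrow> x \<otimes> x = \<one>"
    and card_I: "card I = 15"
    and cent: "\<And>t. t \<in> I \<Longrightarrow> card {g \<in> carrier G. g \<otimes> t = t \<otimes> g} \<le> 4"
  shows "G \<cong> alt_group 5"
proof -
  have fin: "finite (carrier G)" using order order_gt_0_iff_finite by simp
  have finI: "finite I" using card_I by (simp add: card_ge_0_finite)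
  define C where "C t = {g \<in> carrier G. g \<otimes> t = t \<otimes> g}" for t
  have I: "t \<in> carrier G" "t \<noteq> \<one>" "t \<otimes> t = \<one>" if "t \<in> I" for t
    using that by (auto simp: I_def)
  have C_carrier: "C t \<subseteq> carrier G" for t by (auto simp: C_def)
  have C_in: "g \<in> carrier G" if "g \<in> C t" for g t using that by (simp add: C_def)
  have finC: "finite (C t)" for t using C_carrier fin finite_subset by blast
  have subC: "subgroup (C t) G" if "t \<in> carrier G" for t
    using centralizer_subgroup[OF that] by (simp add: C_def)
  have C_sym: "g \<in> C t \<longleftrightarrow> t \<in> C g" if "g \<in> carrier G" "t \<in> carrier G" for g t
    using that by (auto simp: C_def)
  have conj_I: "g \<otimes> t \<otimes> inv g \<in> I" if g: "g \<in> carrier G" and t: "t \<in> I" for g t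
  proof -
    note I[OF t]
    moreover have "g \<otimes> t \<otimes> inv g \<noteq> \<one>"
    proof
      assume "g \<otimes> t \<otimes> inv g = \<one>"
      then have "g \<otimes> t \<otimes> inv g = g \<otimes> \<one> \<otimes> inv g" using g by simp
      then show False using conjugation_is_inj[OF g] I[OF t] by blast
    qed
    moreover have "(g \<otimes> t \<otimes> inv g) \<otimes> (g \<otimes> t \<otimes> inv g) = \<one>"
      unfolding conj_mult[OF g I(1)[OF t] I(1)[OF t], symmetric] using I(3)[OF t] g by simp
    ultimately show ?thesis using g by (simp add: I_def)
  qed
  \<comment> \<open>The class of t lies in \<open>I\<close>, so it has at most 15 elements, and the
    centralizer has at most 4. Their product is 60, so both bounds are attained.\<close>
  have card_C: "card (C t) = 4" if t: "t \<in> I" for t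
  proof -
    let ?O = "(\<lambda>g. g \<otimes> t \<otimes> inv g) ` carrier G"
    have "card ?O * card (C t) = 60"
      using orbit_conjugation_card[OF I(1)[OF t]] order by (simp add: C_def)
    moreover have "card ?O \<le> 15"
      using card_mono[OF finI, of ?O] conj_I t card_I by auto
    moreover have "card (C t) \<le> 4" using cent[OF t] by (simp add: C_def)
    moreover have "card ?O * card (C t) \<le> 15 * card (C t)" using \<open>card ?O \<le> 15\<close> by simp
    ultimately show ?thesis by linarith
  qed
  \<comment> \<open>Lagrange gives exponent 4, and the absence of elements of order 4 lowers it to
    2.\<close>
  have C_sq: "s \<otimes> s = \<one>" if t: "t \<in> I" and s: "s \<in> C t" for s t
  proof -
    interpret S: group "G\<lparr>carrier := C t\<rparr>"
      using subC[OF I(1)[OF t]] subgroup_imp_group by blast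
    have "s [^]\<^bsub>G\<lparr>carrier := C t\<rparr>\<^esub> order (G\<lparr>carrier := C t\<rparr>) = \<one>"
      using S.pow_order_eq_1[of s] s by simp
    moreover have "order (G\<lparr>carrier := C t\<rparr>) = 4" using card_C[OF t] by (simp add: order_def)
    ultimately have "s [^] (4::nat) = \<one>" using nat_pow_consistent by metis
    moreover have "s [^] (4::nat) = (s \<otimes> s) \<otimes> (s \<otimes> s)"
      using C_in[OF s] by (simp add: numeral_eq_Suc m_assoc)
    ultimately show ?thesis using no4[OF C_in[OF s]] by simp
  qed
  \<comment> \<open>Exponent 2 makes \<open>C t\<close> abelian, so it lies in the centralizer of
    each of its elements; equal orders give equality.\<close>
  have C_eq: "C s = C t" if t: "t \<in> I" and s: "s \<in> C t" "s \<noteq> \<one>" for s t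
  proof -
    have sI: "s \<in> I" using C_sq[OF t s(1)] s C_in[OF s(1)] by (simp add: I_def)
    have "C t \<subseteq> C s"
    proof
      fix x assume x: "x \<in> C t"
      have xc: "x \<in> carrier G" "s \<in> carrier G" using C_in[OF x] C_in[OF s(1)] by simp_all
      have "x \<otimes> s \<in> C t" using x s(1) subC[OF I(1)[OF t]] subgroup.m_closed by metis
      then have "(x \<otimes> s) \<otimes> (x \<otimes> s) = \<one>" using C_sq[OF t] by blast
      then have "inv (x \<otimes> s) = x \<otimes> s" using xc by (simp add: inv_equality)
      moreover have "inv x = x" "inv s = s"
        using C_sq[OF t] x s xc by (auto intro: inv_equality)
      ultimately have "x \<otimes> s = s \<otimes> x" using xc by (simp add: inv_mult_group)
      then show "x \<in> C s" using xc by (simp add: C_def)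
    qed
    then show ?thesis using card_C[OF t] card_C[OF sI] finC card_subset_eq by metis
  qed
  define D where "D t = C t - {\<one>}" for t
  have D_I: "D t \<subseteq> I" if "t \<in> I" for t
    using C_sq[OF that] C_in by (auto simp: D_def I_def)
  have self_D: "t \<in> D t" if "t \<in> I" for t
    using I[OF that] by (auto simp: D_def C_def)
  have card_D: "card (D t) = 3" if t: "t \<in> I" for t
    using card_C[OF t] subC[OF I(1)[OF t]] finC by (simp add: D_def subgroup.one_closed)
  define S where "S = D ` I"
  \<comment> \<open>By \<open>C_eq\<close> two of the sets \<open>D t\<close> coincide as soon as
    they meet. Blocks of 3 thus partition the 15 involutions, which yields the degree 5.\<close>
  have "3 * card S = card (\<Union>S)"
  proof (rule card_partition)
    show "finite S" using finI by (simp add: S_def)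
    show "finite (\<Union>S)" using finI D_I by (auto simp: S_def intro: finite_subset)
    show "card c = 3" if "c \<in> S" for c using that card_D by (auto simp: S_def)
    fix c1 c2 assume c: "c1 \<in> S" "c2 \<in> S" "c1 \<noteq> c2"
    then obtain s t where st: "s \<in> I" "t \<in> I" "c1 = D s" "c2 = D t" by (auto simp: S_def)
    show "c1 \<inter> c2 = {}"
    proof (rule ccontr)
      assume "c1 \<inter> c2 \<noteq> {}"
      then obtain u where "u \<in> D s" "u \<in> D t" using st by auto
      then have "C s = C t"
        using C_eq[OF st(1), of u] C_eq[OF st(2), of u] by (simp add: D_def)
      then show False using st c by (simp add: D_def)
    qed
  qed
  moreover have "\<Union>S = I" using D_I self_D by (auto simp: S_def)
  ultimately have card_S: "card S = 5" using card_I by simp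
  have finS: "finite S" using finI by (simp add: S_def)
  define a where "a g V = (\<lambda>h. g \<otimes> h \<otimes> inv g) ` V" for g V
  have a_D: "a g (D t) = D (g \<otimes> t \<otimes> inv g)" if g: "g \<in> carrier G" and t: "t \<in> I" for g t
  proof (rule card_subset_eq)
    have tc: "t \<in> carrier G" using I t by blast
    show "a g (D t) \<subseteq> D (g \<otimes> t \<otimes> inv g)"
    proof
      fix y assume "y \<in> a g (D t)"
      then obtain h where h: "h \<in> D t" "y = g \<otimes> h \<otimes> inv g" by (auto simp: a_def)
      then have hI: "h \<in> I" and ht: "h \<in> carrier G" "h \<otimes> t = t \<otimes> h"
        using D_I[OF t] by (auto simp: D_def C_def)
      have "y \<in> I" using conj_I g hI h by simp
      moreover have "y \<otimes> (g \<otimes> t \<otimes> inv g) = (g \<otimes> t \<otimes> inv g) \<otimes> y"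
        using conj_mult[OF g ht(1) tc] conj_mult[OF g tc ht(1)] ht h by simp
      ultimately show "y \<in> D (g \<otimes> t \<otimes> inv g)" using I by (simp add: D_def C_def)
    qed
    have "inj_on (\<lambda>h. g \<otimes> h \<otimes> inv g) (D t)"
      by (rule inj_onI) (metis C_in DiffD1 D_def conjugation_is_inj g)
    then show "card (a g (D t)) = card (D (g \<otimes> t \<otimes> inv g))"
      using card_D t conj_I[OF g t] by (simp add: a_def card_image)
    show "finite (D (g \<otimes> t \<otimes> inv g))" using finC by (simp add: D_def)
  qed
  have V_carrier: "V \<subseteq> carrier G" if "V \<in> S" for V
    using that C_in by (auto simp: S_def D_def)
  have a_closed: "a g V \<in> S" if "g \<in> carrier G" "V \<in> S" for g V
    using that a_D conj_I by (auto simp: S_def)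
  have a_one: "a \<one> V = V" if "V \<in> S" for V
    using V_carrier[OF that] by (auto simp: a_def image_iff subset_iff)
  have a_mult: "a (g \<otimes> h) V = a g (a h V)" if "g \<in> carrier G" "h \<in> carrier G" "V \<in> S" for g h V
    using V_carrier[OF that(3)] that
    by (auto simp: a_def image_image conj_comp subset_iff intro!: image_cong)
  define N where "N = {g \<in> carrier G. \<forall>V \<in> S. a g V = V}"
  \<comment> \<open>An involution g in the kernel of the action would commute with every involution
    t: either g fixes t under conjugation, or it swaps t with some u in \<open>C t\<close> and fixes
    the involution t u, whose centralizer is again \<open>C t\<close>. Then \<open>C g\<close> would
    contain all 15 involutions.\<close>
  have N_I: False if gN: "g \<in> N" and gI: "g \<in> I" for g
  proof -
    have g: "g \<in> carrier G" "g \<otimes> g = \<one>" using I gI by auto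
    have gi: "inv g = g" using g by (simp add: inv_equality)
    have "t \<in> C g" if t: "t \<in> I" for t
    proof -
      have tc: "t \<in> carrier G" using I t by blast
      define u where "u = g \<otimes> t \<otimes> inv g"
      have "u \<in> a g (D t)" using self_D[OF t] by (auto simp: u_def a_def)
      then have u: "u \<in> D t" using gN t by (auto simp: N_def S_def)
      have uc: "u \<in> carrier G" using g tc by (simp add: u_def)
      have "g \<in> C t"
      proof (cases "u = t")
        case True
        then show ?thesis using conj_eq_self_iff g tc by (auto simp: u_def C_def)
      next
        case False
        have gug: "g \<otimes> u \<otimes> inv g = t"
          using conj_comp[OF g(1) g(1) tc] g tc by (simp add: u_def)
        have tu: "t \<otimes> u = u \<otimes> t" using u by (auto simp: D_def C_def)
        have "t \<otimes> u \<noteq> \<one>"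
        proof
          assume "t \<otimes> u = \<one>"
          then have "t \<otimes> u = t \<otimes> t" using I t by simp
          then show False using tc uc False by simp
        qed
        moreover have "t \<otimes> u \<in> C t"
          using self_D[OF t] u subC[OF tc] subgroup.m_closed by (fastforce simp: D_def)
        ultimately have "C (t \<otimes> u) = C t" using C_eq[OF t] by blast
        moreover have "g \<otimes> (t \<otimes> u) \<otimes> inv g = t \<otimes> u"
          using conj_mult[OF g(1) tc uc] gug tu by (simp flip: u_def)
        then have "g \<in> C (t \<otimes> u)" using conj_eq_self_iff[OF g(1)] tc uc g by (simp add: C_def)
        ultimately show ?thesis by simp
      qed
      then show ?thesis using C_sym g tc by blast
    qed
    then have "card I \<le> card (C g)" using card_mono[OF finC] by blast
    then show False using card_C[OF gI] card_I by simp
  qed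
  have N_inv: "a (inv g) V = V" if "g \<in> N" "V \<in> S" for g V
    using a_mult[of "inv g" g V] a_one that by (auto simp: N_def)
  \<comment> \<open>For g in the kernel, the commutator c of g and t lies in the kernel and in
    \<open>C t\<close>, so it is trivial by \<open>N_I\<close>. Hence g itself is in
    \<open>C t\<close>, and if nontrivial it is an involution in the kernel.\<close>
  have faithful: "g = \<one>" if g: "g \<in> carrier G" "\<And>V. V \<in> S \<Longrightarrow> a g V = V" for g
  proof (rule ccontr)
    assume g1: "g \<noteq> \<one>"
    have gN: "g \<in> N" using g by (simp add: N_def)
    obtain t where t: "t \<in> I" using card_I by fastforce
    have tc: "t \<in> carrier G" using I t by blast
    define c where "c = (g \<otimes> t \<otimes> inv g) \<otimes> inv t"
    have "g \<otimes> t \<otimes> inv g \<in> a g (D t)" using self_D[OF t] by (auto simp: a_def)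
    then have "g \<otimes> t \<otimes> inv g \<in> C t" using g t by (auto simp: S_def D_def)
    moreover have "inv t \<in> C t" using subC[OF tc] self_D[OF t] subgroup.m_inv_closed by (fastforce simp: D_def)
    ultimately have cC: "c \<in> C t" unfolding c_def using subC[OF tc] subgroup.m_closed by metis
    have c_eq: "c = g \<otimes> (t \<otimes> (inv g \<otimes> inv t))" using g tc by (simp add: c_def m_assoc)
    have "a c V = V" if V: "V \<in> S" for V
    proof -
      have "a t (a (inv t) V) = V" using a_mult[OF tc _ V, of "inv t"] tc a_one V by simp
      then show ?thesis
        unfolding c_eq using V g tc N_inv[OF gN] by (simp add: a_mult a_closed)
    qed
    then have "c \<in> N" using C_in[OF cC] by (simp add: N_def)
    then have "c = \<one>" using N_I cC D_I[OF t] by (auto simp: D_def)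
    then have "g \<otimes> t \<otimes> inv g = t"
      using inv_equality[of "g \<otimes> t \<otimes> inv g" "inv t"] g tc by (simp add: c_def)
    then have "g \<in> C t" using conj_eq_self_iff g tc by (simp add: C_def)
    then have "g \<in> I" using D_I[OF t] g1 by (auto simp: D_def)
    then show False using N_I gN by blast
  qed
  obtain f where f: "f \<in> hom G (sym_group (card S))" "inj_on f (carrier G)"
    by (rule embed_into_sym_group[where a = a, OF finS a_closed a_one a_mult faithful])
  then have f: "f \<in> hom G (sym_group 5)" "inj_on f (carrier G)" by (simp_all add: card_S)
  interpret f: group_hom G "sym_group 5" f
    using f(1) sym_group_is_group by (simp add: group_hom_def group_hom_axioms_def)
  have "card (f ` carrier G) = 60" using card_image[OF f(2)] order by (simp add: order_def)
  then have "f ` carrier G = carrier (alt_group 5)"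
    using index_2_subgroup_sym_group[OF f.img_is_subgroup] by (simp add: fact_numeral)
  then have "f \<in> iso G (alt_group 5)"
    using f by (simp add: iso_def bij_betw_def hom_def alt_group_mult sym_group_mult Pi_def) blast
  then show ?thesis by (rule is_isoI)
qed

lemma (in group) subgroup_pow_card_eq_one:
  assumes "subgroup H G" "finite (carrier G)" "x \<in> H"
  shows "x [^] card H = \<one>"
proof -
  interpret H: group "G\<lparr>carrier := H\<rparr>" using assms subgroup_imp_group by blast
  have "x [^]\<^bsub>G\<lparr>carrier := H\<rparr>\<^esub> order (G\<lparr>carrier := H\<rparr>) = \<one>"
    using H.pow_order_eq_1[of x] assms by simp
  then show ?thesis using nat_pow_consistent[of x _ H] by (simp add: order_def)
qed

text \<open>All S-orbits on X are regular. Induction removes one such orbit at a time, each of size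
  |S|.\<close>

lemma (in group_action) semiregular_card_dvd:
  assumes S: "subgroup S G" "finite S" and "finite X" "X \<subseteq> E"
    and "\<And>s x. s \<in> S \<Longrightarrow> x \<in> X \<Longrightarrow> \<phi> s x \<in> X"
    and "\<And>s x. s \<in> S \<Longrightarrow> x \<in> X \<Longrightarrow> \<phi> s x = x \<Longrightarrow> s = \<one>"
  shows "card S dvd card X"
  using assms(3-)
proof (induction X rule: finite_psubset_induct)
  case (psubset X)
  interpret group G using group_hom group_hom.axioms(1) by blast
  interpret S: subgroup S G by fact
  show ?case
  proof (cases "X = {}")
    case False
    then obtain x where x: "x \<in> X" by blast
    then have xE: "x \<in> E" using psubset by blast
    let ?O = "(\<lambda>s. \<phi> s x) ` S"
    have OX: "?O \<subseteq> X" using psubset.prems(2) x by blast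
    have "\<one> \<in> S" by simp
    then have "\<phi> \<one> x \<in> ?O" by (rule imageI)
    then have Ox: "X - ?O \<subset> X" using OX by blast
    have "inj_on (\<lambda>s. \<phi> s x) S"
    proof (rule inj_onI)
      fix s t assume st: "s \<in> S" "t \<in> S" "\<phi> s x = \<phi> t x"
      have "\<phi> (inv t \<otimes> s) x = x"
        using st xE composition_rule[OF xE, of "inv t" s] orbit_sym_aux[OF _ xE, of t] by simp
      then have "inv t \<otimes> s = \<one>"
        using psubset.prems(3)[OF _ x] st S.m_closed S.m_inv_closed by blast
      then show "s = t" using st by (metis S.mem_carrier inv_closed inv_equality inv_inv)
    qed
    then have cO: "card ?O = card S" by (rule card_image)
    have "card S dvd card (X - ?O)"
    proof (rule psubset.IH[OF Ox])
      show "X - ?O \<subseteq> E" using psubset by blast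
      fix s y assume sy: "s \<in> S" "y \<in> X - ?O"
      have yE: "y \<in> E" using sy psubset by blast
      have "\<phi> s y \<notin> ?O"
      proof
        assume "\<phi> s y \<in> ?O"
        then obtain t where t: "t \<in> S" "\<phi> s y = \<phi> t x" by blast
        have "y = \<phi> (inv s) (\<phi> s y)" using orbit_sym_aux[OF _ yE refl] sy by simp
        also have "\<dots> = \<phi> (inv s \<otimes> t) x" using t sy xE by (simp add: composition_rule)
        also have "\<dots> \<in> ?O" using t sy by blast
        finally show False using sy by blast
      qed
      then show "\<phi> s y \<in> X - ?O" using psubset.prems(2) sy by blast
      show "\<phi> s y = y \<Longrightarrow> s = \<one>" using psubset.prems(3) sy by blast
    qed
    moreover have "card X = card (X - ?O) + card ?O"
      using card_Diff_subset[OF finite_subset[OF OX psubset.hyps] OX] card_mono[OF psubset.hyps OX]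
      by simp
    ultimately show ?thesis using cO by simp
  qed simp
qed

section \<open>Counting fixed points\<close>

locale few_fixed_points = group_action +
  assumes fin: "finite (carrier G)"
    and fixed: "\<And>g. g \<in> carrier G \<Longrightarrow> g \<noteq> \<one> \<Longrightarrow> card (invariants E \<phi> g) \<in> {1, 2}"
    and ex_unique: "\<exists>g \<in> carrier G - {\<one>}. card (invariants E \<phi> g) = 1"
    and orbit_ge_3: "\<And>Orb. Orb \<in> orbits G E \<phi> \<Longrightarrow> 3 \<le> card Orb"
begin

sublocale group G using group_hom group_hom.axioms(1) by blast

abbreviation Fix where "Fix \<equiv> invariants E \<phi>"
abbreviation Stab where "Stab \<equiv> stabilizer G \<phi>"
abbreviation Ker where "Ker \<equiv> one_point_kernel G E \<phi>"
abbreviation Gam where "Gam \<equiv> unique_fixed_points G E \<phi>"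
abbreviation orb where "orb \<equiv> orbit G \<phi>"

lemma finite_Stab [simp]: "finite (Stab x)"
  using fin stabilizer_subset finite_subset by blast

lemma finite_orb [simp]: "finite (orb x)"
proof -
  have "orb x = (\<lambda>g. \<phi> g x) ` carrier G" by (auto simp: orbit_def)
  then show ?thesis using fin by simp
qed

lemma orb_subset: "x \<in> E \<Longrightarrow> orb x \<subseteq> E"
  using element_image by (auto simp: orbit_def)

lemma orb_eq:
  assumes "x \<in> E" "y \<in> orb x" shows "orb y = orb x"
proof -
  have "y \<in> E" using assms orb_subset by blast
  moreover have "orb x \<in> orbits G E \<phi>" "orb y \<in> orbits G E \<phi>"
    using \<open>y \<in> E\<close> assms by (auto simp: orbits_def)
  ultimately show ?thesis using disjoint_union orbit_refl assms by blast
qed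

lemma card_orb: "x \<in> E \<Longrightarrow> 3 \<le> card (orb x)"
  by (rule orbit_ge_3) (auto simp: orbits_def)

lemma card_Stab_orb:
  assumes "x \<in> E" "y \<in> orb x" shows "card (Stab y) = card (Stab x)"
proof -
  have "y \<in> E" using assms orb_subset by blast
  then have "card (orb x) * card (Stab y) = card (orb x) * card (Stab x)"
    using orbit_stabilizer_theorem assms orb_eq by metis
  then show ?thesis using card_orb[OF assms(1)] by auto
qed

lemma one_Stab: "x \<in> E \<Longrightarrow> \<one> \<in> Stab x"
  by (rule stabilizer_one_closed)

lemma finite_Fix: "g \<in> carrier G \<Longrightarrow> g \<noteq> \<one> \<Longrightarrow> finite (Fix g)"
  using fixed[of g] by (auto intro!: card_ge_0_finite)

lemma Fix_iff: "x \<in> E \<Longrightarrow> g \<in> carrier G \<Longrightarrow> x \<in> Fix g \<longleftrightarrow> g \<in> Stab x"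
  by (auto simp: invariants_def stabilizer_def)

lemma Fix_subset: "Fix g \<subseteq> E"
  by (auto simp: invariants_def)

lemma Fix_eq_two:
  assumes "g \<in> carrier G" "g \<noteq> \<one>" "x \<in> Fix g" "y \<in> Fix g" "x \<noteq> y"
  shows "Fix g = {x, y}"
proof -
  have "card (Fix g) \<le> 2" using fixed assms by force
  then have "{x, y} = Fix g"
    using assms finite_Fix by (intro card_seteq) auto
  then show ?thesis by simp
qed

text \<open>The working form of the bound on fixed points: two-point stabilizers sharing the point x
  meet trivially.\<close>

lemma Stab_three:
  assumes "x \<in> E" "y \<in> E" "z \<in> E" "x \<noteq> y" "x \<noteq> z" "y \<noteq> z" "g \<in> Stab x" "g \<in> Stab y" "g \<in> Stab z"
  shows "g = \<one>"
proof (rule ccontr)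
  assume "g \<noteq> \<one>"
  moreover have g: "g \<in> carrier G" using assms stabilizer_subset by blast
  ultimately have "Fix g = {x, y}" using assms Fix_eq_two Fix_iff by metis
  moreover have "z \<in> Fix g" using assms g by (simp add: Fix_iff)
  ultimately show False using assms(5,6) by simp
qed

lemma Fix_conj:
  assumes g: "g \<in> carrier G" and s: "s \<in> carrier G"
  shows "Fix (g \<otimes> s \<otimes> inv g) = \<phi> g ` Fix s"
proof
  show "\<phi> g ` Fix s \<subseteq> Fix (g \<otimes> s \<otimes> inv g)"
  proof
    fix y assume "y \<in> \<phi> g ` Fix s"
    then obtain x where x: "x \<in> E" "\<phi> s x = x" "y = \<phi> g x" by (auto simp: invariants_def)
    have yE: "y \<in> E" using x element_image g by blast
    have "\<phi> (inv g) y = x" using orbit_sym_aux g x by blast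
    then show "y \<in> Fix (g \<otimes> s \<otimes> inv g)"
      using x yE g s by (simp add: composition_rule invariants_def)
  qed
  show "Fix (g \<otimes> s \<otimes> inv g) \<subseteq> \<phi> g ` Fix s"
  proof
    fix y assume y: "y \<in> Fix (g \<otimes> s \<otimes> inv g)"
    then have yE: "y \<in> E" and eq: "\<phi> (g \<otimes> s \<otimes> inv g) y = y" by (auto simp: invariants_def)
    define x where "x = \<phi> (inv g) y"
    have xE: "x \<in> E" using yE element_image g x_def by blast
    have y_eq: "y = \<phi> g x" using orbit_sym_aux[of "inv g" y x] g yE x_def by simp
    have sxE: "\<phi> s x \<in> E" using element_image s xE by blast
    have "\<phi> (g \<otimes> s \<otimes> inv g) y = \<phi> g (\<phi> s x)"
      using yE xE g s by (simp add: composition_rule flip: x_def)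
    then have "\<phi> g (\<phi> s x) = \<phi> g x" using eq y_eq by metis
    then have "\<phi> s x = x" using inj_prop[OF g] xE sxE by (meson inj_onD)
    then show "y \<in> \<phi> g ` Fix s" using xE y_eq by (auto simp: invariants_def)
  qed
qed

lemma Ker_eq: "x \<in> E \<Longrightarrow> Ker x = {g \<in> carrier G. g = \<one> \<or> Fix g = {x}}"
  using one_Stab by (auto simp: one_point_kernel_def stabilizer_def invariants_def)

lemma finite_Ker: "x \<in> E \<Longrightarrow> finite (Ker x)"
  using fin by (simp add: Ker_eq)

lemma Ker_subset: "x \<in> E \<Longrightarrow> Ker x \<subseteq> Stab x"
  using one_Stab by (auto simp: one_point_kernel_def)

lemma Gam_E: "x \<in> Gam \<Longrightarrow> x \<in> E"
  by (auto simp: unique_fixed_points_def)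

lemma Gam_iff:
  assumes "x \<in> E" shows "x \<in> Gam \<longleftrightarrow> 2 \<le> card (Ker x)"
proof -
  have "x \<in> Gam \<longleftrightarrow> Ker x - {\<one>} \<noteq> {}"
    using assms by (auto simp: unique_fixed_points_def Ker_eq)
  also have "\<dots> \<longleftrightarrow> 0 < card (Ker x - {\<one>})"
    using finite_Ker[OF assms] by (simp add: card_gt_0_iff)
  also have "\<dots> \<longleftrightarrow> 2 \<le> card (Ker x)"
    using finite_Ker[OF assms] by (subst card_Diff_singleton) (auto simp: Ker_eq[OF assms])
  finally show ?thesis .
qed

lemma card_Ker_ge_1: "x \<in> E \<Longrightarrow> 1 \<le> card (Ker x)"
  using finite_Ker[of x] card_gt_0_iff[of "Ker x"] by (force simp: Ker_eq)

text \<open>Conjugation by g translates fixed point sets by g, so it embeds one kernel in the other.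
  The inverse of g supplies the reverse inequality, whence |\<open>Ker x\<close>| is constant on
  orbits.\<close>

lemma card_Ker_le:
  assumes x: "x \<in> E" and g: "g \<in> carrier G"
  shows "card (Ker x) \<le> card (Ker (\<phi> g x))"
proof (rule card_inj_on_le)
  have gx: "\<phi> g x \<in> E" using assms element_image by blast
  show "finite (Ker (\<phi> g x))" using finite_Ker gx by blast
  show "inj_on (\<lambda>s. g \<otimes> s \<otimes> inv g) (Ker x)"
    using conjugation_is_inj[OF g] x by (auto simp: Ker_eq inj_on_def)
  show "(\<lambda>s. g \<otimes> s \<otimes> inv g) ` Ker x \<subseteq> Ker (\<phi> g x)"
  proof
    fix t assume "t \<in> (\<lambda>s. g \<otimes> s \<otimes> inv g) ` Ker x"
    then obtain s where s: "s \<in> carrier G" "s = \<one> \<or> Fix s = {x}" "t = g \<otimes> s \<otimes> inv g"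
      using x by (auto simp: Ker_eq)
    then show "t \<in> Ker (\<phi> g x)"
      using g Fix_conj[OF g s(1)] by (auto simp: Ker_eq[OF gx])
  qed
qed

lemma card_Ker_orb:
  assumes x: "x \<in> E" and y: "y \<in> orb x"
  shows "card (Ker y) = card (Ker x)"
proof -
  obtain g where g: "g \<in> carrier G" "y = \<phi> g x" using y by (auto simp: orbit_def)
  have "y \<in> E" using x y orb_subset by blast
  moreover have "\<phi> (inv g) y = x" using orbit_sym_aux g x by blast
  ultimately show ?thesis
    using card_Ker_le[OF x g(1)] card_Ker_le[of y "inv g"] g by force
qed

lemma Gam_orb: "x \<in> E \<Longrightarrow> y \<in> orb x \<Longrightarrow> y \<in> Gam \<longleftrightarrow> x \<in> Gam"
  using Gam_iff[of x] Gam_iff[of y] card_Ker_orb[of x y] orb_subset[of x] by auto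

section \<open>Weighted count of the nonregular orbits\<close>

abbreviation NR where "NR \<equiv> nonregular_orbits G E \<phi>"

text \<open>The union of the nonregular orbits, over which the weights are summed.\<close>

definition moved where "moved = {x \<in> E. Stab x \<noteq> {\<one>}}"

text \<open>\<open>E\<close> may be infinite through its regular orbits, but this part is covered by
  finitely many fixed point sets of size at most 2.\<close>

lemma finite_moved: "finite moved"
proof (rule finite_subset)
  show "moved \<subseteq> (\<Union>g \<in> carrier G - {\<one>}. Fix g)"
  proof
    fix x assume x: "x \<in> moved"
    then have xE: "x \<in> E" by (simp add: moved_def)
    obtain g where g: "g \<in> Stab x" "g \<noteq> \<one>" using x one_Stab[OF xE] by (auto simp: moved_def)
    then have gG: "g \<in> carrier G" using stabilizer_subset by blast
    then show "x \<in> (\<Union>g \<in> carrier G - {\<one>}. Fix g)" using g Fix_iff[OF xE gG] by blast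
  qed
  show "finite (\<Union>g \<in> carrier G - {\<one>}. Fix g)" using fin finite_Fix by blast
qed

lemma Fix_moved: "g \<in> carrier G \<Longrightarrow> g \<noteq> \<one> \<Longrightarrow> Fix g \<subseteq> moved"
  using Fix_iff Fix_subset by (force simp: moved_def)

lemma card_Stab_moved:
  assumes "x \<in> moved" shows "2 \<le> card (Stab x)"
proof -
  have x: "x \<in> E" "Stab x \<noteq> {\<one>}" using assms by (auto simp: moved_def)
  then have "card (Stab x) \<noteq> 1" using one_Stab[OF x(1)] by (metis card_1_singletonE singletonD)
  moreover have "card (Stab x) \<noteq> 0" using one_Stab[OF x(1)] by auto
  ultimately show ?thesis by linarith
qed

lemma Gam_moved: "Gam \<subseteq> moved"
proof
  fix x assume x: "x \<in> Gam"
  then have xE: "x \<in> E" by (rule Gam_E)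
  have "2 \<le> card (Ker x)" using x Gam_iff[OF xE] by simp
  also have "\<dots> \<le> card (Stab x)" using Ker_subset[OF xE] by (intro card_mono) auto
  finally show "x \<in> moved" using xE by (auto simp: moved_def)
qed

lemma moved_orb: "x \<in> moved \<Longrightarrow> orb x \<subseteq> moved"
proof
  fix y assume x: "x \<in> moved" and y: "y \<in> orb x"
  have xE: "x \<in> E" using x by (simp add: moved_def)
  have "2 \<le> card (Stab y)" using card_Stab_moved[OF x] card_Stab_orb[OF xE y] by simp
  then show "y \<in> moved" using orb_subset[OF xE] y by (auto simp: moved_def)
qed

lemma NR_eq: "NR = orb ` moved"
proof
  show "NR \<subseteq> orb ` moved"
  proof
    fix Q assume "Q \<in> NR"
    then obtain x y where x: "x \<in> E" "Q = orb x" and y: "y \<in> Q" "Stab y \<noteq> {\<one>}"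
      by (auto simp: nonregular_orbits_def orbits_def)
    have "y \<in> moved" using y x orb_subset[OF x(1)] by (auto simp: moved_def)
    moreover have "Q = orb y" using orb_eq[OF x(1), of y] x y by simp
    ultimately show "Q \<in> orb ` moved" by blast
  qed
  show "orb ` moved \<subseteq> NR"
    using orbit_refl by (force simp: nonregular_orbits_def orbits_def moved_def)
qed

text \<open>Double counting of the pairs of a nontrivial g and a point of \<open>Fix g\<close>,
  where g counts twice if it has only one fixed point. A point x collects |\<open>Stab x\<close>| -
  1, and a further |\<open>Ker x\<close>| - 1 from the elements fixing x alone.\<close>

lemma weight_sum:
  "(\<Sum>x\<in>moved. card (Stab x) + card (Ker x) - 2) = 2 * (order G - 1)"
proof -
  let ?C = "carrier G - {\<one>}"
  define w :: "'a \<Rightarrow> nat" where "w g = (if card (Fix g) = 1 then 2 else 1)" for g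
  have "(\<Sum>g\<in>?C. \<Sum>x\<in>{x \<in> moved. x \<in> Fix g}. w g) = (\<Sum>g\<in>?C. 2)"
  proof (rule sum.cong[OF refl])
    fix g assume g: "g \<in> ?C"
    then have "{x \<in> moved. x \<in> Fix g} = Fix g" using Fix_moved by blast
    then show "(\<Sum>x\<in>{x \<in> moved. x \<in> Fix g}. w g) = 2"
      using fixed[of g] g by (auto simp: w_def)
  qed
  also have "\<dots> = 2 * (order G - 1)"
    using fin by (simp add: order_def)
  finally have 1: "(\<Sum>g\<in>?C. \<Sum>x\<in>{x \<in> moved. x \<in> Fix g}. w g) = 2 * (order G - 1)" .
  have "(\<Sum>g\<in>?C. \<Sum>x\<in>{x \<in> moved. x \<in> Fix g}. w g) = (\<Sum>x\<in>moved. \<Sum>g\<in>{g \<in> ?C. x \<in> Fix g}. w g)"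
    using fin finite_moved by (intro sum.swap_restrict) auto
  also have "\<dots> = (\<Sum>x\<in>moved. card (Stab x) + card (Ker x) - 2)"
  proof (rule sum.cong[OF refl])
    fix x assume "x \<in> moved"
    then have x: "x \<in> E" by (simp add: moved_def)
    have S: "{g \<in> ?C. x \<in> Fix g} = Stab x - {\<one>}"
      using Fix_iff[OF x] stabilizer_subset by blast
    have "(\<Sum>g\<in>Stab x - {\<one>}. w g) = (\<Sum>g\<in>Stab x - {\<one>}. 1 + (if card (Fix g) = 1 then 1 else 0))"
      by (rule sum.cong) (auto simp: w_def)
    also have "\<dots> = card (Stab x - {\<one>}) + card {g \<in> Stab x - {\<one>}. card (Fix g) = 1}"
      by (simp only: sum.distrib) (simp add: sum.If_cases Int_def)
    also have "{g \<in> Stab x - {\<one>}. card (Fix g) = 1} = Ker x - {\<one>}"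
    proof -
      have "card (Fix g) = 1 \<longleftrightarrow> Fix g = {x}" if "g \<in> Stab x" for g
        using that Fix_iff[OF x, of g] stabilizer_subset[of x] by (auto simp: card_1_singleton_iff)
      moreover have "g \<in> Stab x" if "g \<in> carrier G" "Fix g = {x}" for g
        using that Fix_iff[OF x, of g] by simp
      ultimately show ?thesis using stabilizer_subset[of x] by (auto simp: Ker_eq[OF x])
    qed
    also have "card (Stab x - {\<one>}) + card (Ker x - {\<one>}) = card (Stab x) + card (Ker x) - 2"
      using one_Stab[OF x] finite_Ker[OF x] card_Ker_ge_1[OF x] card_gt_0_iff[of "Stab x"]
      by (auto simp: card_Diff_singleton Ker_eq[OF x])
    finally show "(\<Sum>g\<in>{g \<in> ?C. x \<in> Fix g}. w g) = card (Stab x) + card (Ker x) - 2"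
      by (simp only: S)
  qed
  finally show ?thesis using 1 by simp
qed

lemma orbit_weight_sum:
  "(\<Sum>Q\<in>NR. \<Sum>x\<in>Q. card (Stab x) + card (Ker x) - 2) = 2 * (order G - 1)"
proof -
  have U: "\<Union>NR = moved"
    using moved_orb orbit_refl by (fastforce simp: NR_eq moved_def)
  have "sum f (\<Union>NR) = (sum \<circ> sum) f NR" for f :: "'c \<Rightarrow> nat"
  proof (rule sum.Union_disjoint)
    show "\<forall>A\<in>NR. finite A" by (auto simp: NR_eq)
    show "\<forall>A\<in>NR. \<forall>B\<in>NR. A \<noteq> B \<longrightarrow> A \<inter> B = {}"
      using disjoint_union by (auto simp: nonregular_orbits_def)
  qed
  then show ?thesis using weight_sum by (simp add: U)
qed

lemma orbit_weight:
  assumes "x \<in> E"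
  shows "(\<Sum>y\<in>orb x. card (Stab y) + card (Ker y) - 2) = card (orb x) * (card (Stab x) + card (Ker x) - 2)"
proof -
  have "(\<Sum>y\<in>orb x. card (Stab y) + card (Ker y) - 2) = (\<Sum>y\<in>orb x. card (Stab x) + card (Ker x) - 2)"
    by (rule sum.cong) (simp_all add: card_Stab_orb[OF assms] card_Ker_orb[OF assms])
  then show ?thesis by simp
qed

lemma orbit_weight_Gam:
  assumes "x \<in> Gam"
  shows "order G \<le> (\<Sum>y\<in>orb x. card (Stab y) + card (Ker y) - 2)"
proof -
  have x: "x \<in> E" using assms by (rule Gam_E)
  have "card (Stab x) \<le> card (Stab x) + card (Ker x) - 2" using Gam_iff[OF x] assms by simp
  then show ?thesis
    unfolding orbit_weight[OF x] orbit_stabilizer_theorem[OF x, symmetric] by (rule mult_le_mono2)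
qed

text \<open>Outside \<Gamma> the kernel is trivial, so each point weighs |\<open>Stab x\<close>| -
  1. The additive form avoids truncated subtraction.\<close>

lemma orbit_weight_not_Gam:
  assumes "x \<in> moved" "x \<notin> Gam"
  shows "(\<Sum>y\<in>orb x. card (Stab y) + card (Ker y) - 2) + card (orb x) = order G"
    and "2 * card (orb x) \<le> order G"
proof -
  have x: "x \<in> E" using assms by (simp add: moved_def)
  have "card (Ker x) = 1" using Gam_iff[OF x] card_Ker_ge_1[OF x] assms by simp
  moreover obtain e where "card (Stab x) = Suc e" "1 \<le> e"
    using card_Stab_moved[OF assms(1)] by (cases "card (Stab x)") auto
  ultimately show "(\<Sum>y\<in>orb x. card (Stab y) + card (Ker y) - 2) + card (orb x) = order G"
    unfolding orbit_weight[OF x] orbit_stabilizer_theorem[OF x, symmetric] by simp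
  show "2 * card (orb x) \<le> order G"
    using mult_le_mono2[OF card_Stab_moved[OF assms(1)], of "card (orb x)"]
    unfolding orbit_stabilizer_theorem[OF x, symmetric] by simp
qed

lemma ex_Gam: "Gam \<noteq> {}"
proof -
  obtain g where g: "g \<in> carrier G - {\<one>}" "card (Fix g) = 1" using ex_unique by blast
  then obtain x where "Fix g = {x}" by (auto simp: card_1_singleton_iff)
  then have "x \<in> Gam" using g Fix_subset[of g] by (auto simp: unique_fixed_points_def)
  then show ?thesis by blast
qed

lemma two_nonregular_orbits:
  shows "\<And>x. x \<in> Gam \<Longrightarrow> orb x = Gam"
    and "Gam \<in> NR"
    and "\<exists>D. NR - {Gam} = {D} \<and> (\<forall>x\<in>Gam. card D = card Gam * (card (Ker x) - 2) + 2)"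
proof -
  define W :: "'c set \<Rightarrow> nat" where "W Q = (\<Sum>y\<in>Q. card (Stab y) + card (Ker y) - 2)" for Q
  have finNR: "finite NR" using finite_moved by (simp add: NR_eq)
  have sumW: "sum W NR = 2 * (order G - 1)" using orbit_weight_sum by (simp add: W_def)
  have n: "0 < order G" using fin order_gt_0_iff_finite by blast
  have sub: "sum W T \<le> 2 * (order G - 1)" if "T \<subseteq> NR" for T
    using sum_mono2[OF finNR that, of W] sumW by simp
  obtain z where z: "z \<in> Gam" using ex_Gam by blast
  have zE: "z \<in> E" using z by (rule Gam_E)
  have orb_NR: "orb x \<in> NR" if "x \<in> moved" for x using that by (simp add: NR_eq)
  have Wz: "order G \<le> W (orb x)" if "x \<in> Gam" for x using orbit_weight_Gam that by (simp add: W_def)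
  have one: "orb x = orb z" if x: "x \<in> Gam" for x
  proof (rule ccontr)
    assume "orb x \<noteq> orb z"
    then have "sum W {orb x, orb z} = W (orb x) + W (orb z)" by simp
    moreover have "sum W {orb x, orb z} \<le> 2 * (order G - 1)"
      using orb_NR Gam_moved x z by (intro sub) blast
    ultimately show False using Wz[OF x] Wz[OF z] n by linarith
  qed
  have Gz: "Gam = orb z"
    using one orbit_refl Gam_E Gam_orb[OF zE] z by blast
  have WGam: "order G \<le> W Gam" using Wz[OF z] Gz by simp
  show Gx: "orb x = Gam" if "x \<in> Gam" for x using one[OF that] Gz by simp
  show "Gam \<in> NR" using orb_NR[of z] z Gam_moved Gz by auto
  have not: "x \<notin> Gam" if "x \<in> moved" "orb x \<noteq> Gam" for x using that Gx by blast
  have uniq: "orb x = orb y"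
    if x: "x \<in> moved" "orb x \<noteq> Gam" and y: "y \<in> moved" "orb y \<noteq> Gam" for x y
  proof (rule ccontr)
    assume "orb x \<noteq> orb y"
    then have "sum W {Gam, orb x, orb y} = W Gam + (W (orb x) + W (orb y))"
      using x(2)[symmetric] y(2)[symmetric] by simp
    moreover have "sum W {Gam, orb x, orb y} \<le> 2 * (order G - 1)"
      using orb_NR x y \<open>Gam \<in> NR\<close> by (intro sub) blast
    moreover note orbit_weight_not_Gam[OF x(1) not[OF x], folded W_def]
      orbit_weight_not_Gam[OF y(1) not[OF y], folded W_def]
    ultimately show False using WGam n by linarith
  qed
  \<comment> \<open>The weight of a single point of \<Gamma>, named to remove the truncated
    subtraction; \<open>W2\<close> below says that \<Gamma> weighs |G| + |\<Gamma>|(q - 2).\<close>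
  obtain w where w: "card (Stab z) + card (Ker z) = w + 2"
    using Gam_iff[OF zE] z by (metis add.commute le_Suc_ex trans_le_add2)
  have WG: "W Gam = card Gam * w" using orbit_weight[OF zE] w by (simp add: W_def Gz)
  have ge: "card Gam * card (Stab z) = order G" using orbit_stabilizer_theorem[OF zE] Gz by simp
  have "card Gam * (card (Stab z) + card (Ker z)) = W Gam + 2 * card Gam"
    unfolding w WG by (simp add: algebra_simps)
  then have W2: "order G + card Gam * card (Ker z) = W Gam + 2 * card Gam"
    by (simp only: distrib_left ge)
  \<comment> \<open>Alone, \<Gamma> would carry weight at most 2|G| - 2|\<Gamma>|, since |\<Gamma>|q
    is at most |G|. This falls short of 2|G| - 2 because |\<Gamma>| is at least 3.\<close>
  have "\<exists>x\<in>moved. orb x \<noteq> Gam"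
  proof (rule ccontr)
    assume "\<not> (\<exists>x\<in>moved. orb x \<noteq> Gam)"
    then have "NR \<subseteq> {Gam}" by (auto simp: NR_eq)
    then have "NR = {Gam}" using \<open>Gam \<in> NR\<close> by auto
    then have "W Gam = 2 * (order G - 1)" using sumW by simp
    moreover have "card (Ker z) \<le> card (Stab z)"
      using Ker_subset[OF zE] by (intro card_mono) auto
    then have "card Gam * card (Ker z) \<le> order G"
      unfolding ge[symmetric] by (rule mult_le_mono2)
    moreover have "3 \<le> card Gam" using card_orb[OF zE] Gz by simp
    ultimately show False using W2 n by linarith
  qed
  then obtain x where x: "x \<in> moved" "orb x \<noteq> Gam" by blast
  have NR: "NR = {Gam, orb x}"
    using uniq[OF x] orb_NR[OF x(1)] \<open>Gam \<in> NR\<close> by (auto simp: NR_eq)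
  have "W Gam + W (orb x) = 2 * (order G - 1)"
    using sumW x(2) unfolding NR by simp
  \<comment> \<open>The second orbit weighs |G| minus its length; inserting this and
    \<open>W2\<close> into the total determines that length.\<close>
  then have "card Gam * card (Ker z) + 2 = card (orb x) + 2 * card Gam"
    using orbit_weight_not_Gam[OF x(1) not[OF x], folded W_def] W2 n by linarith
  moreover obtain k where "card (Ker z) = k + 2"
    using Gam_iff[OF zE] z by (metis add.commute le_Suc_ex)
  ultimately have "card (orb x) = card Gam * (card (Ker z) - 2) + 2" by (simp add: algebra_simps)
  moreover have "card (Ker y) = card (Ker z)" if "y \<in> Gam" for y
    using card_Ker_orb[OF zE] that Gz by simp
  ultimately have "\<forall>y\<in>Gam. card (orb x) = card Gam * (card (Ker y) - 2) + 2" by simp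
  moreover have "NR - {Gam} = {orb x}" using NR x(2) by auto
  ultimately show "\<exists>D. NR - {Gam} = {D} \<and> (\<forall>x\<in>Gam. card D = card Gam * (card (Ker x) - 2) + 2)"
    by blast
qed

section \<open>Suborbits of a point stabilizer\<close>

definition suborb where "suborb x y = (\<lambda>g. \<phi> g y) ` Stab x"

text \<open>Identifies suborbits as orbits of the induced action of \<open>Stab x\<close>, so that
  orbit-stabilizer and symmetry carry over.\<close>

lemma suborb_action:
  assumes "x \<in> E"
  shows "group_action (G\<lparr>carrier := Stab x\<rparr>) E \<phi>"
    and "orbit (G\<lparr>carrier := Stab x\<rparr>) \<phi> y = suborb x y"
    and "stabilizer (G\<lparr>carrier := Stab x\<rparr>) \<phi> y = Stab x \<inter> Stab y"
  using induced_action[OF stabilizer_subgroup[OF assms]]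
  by (auto simp: orbit_def suborb_def stabilizer_def)

lemma card_suborb:
  assumes "x \<in> E" "y \<in> E"
  shows "card (suborb x y) * card (Stab x \<inter> Stab y) = card (Stab x)"
  using group_action.orbit_stabilizer_theorem[OF suborb_action(1)[OF assms(1)] assms(2)]
  by (simp add: suborb_action(2,3)[OF assms(1)] order_def)

lemma finite_suborb [simp]: "finite (suborb x y)"
  by (simp add: suborb_def)

lemma suborb_subset_orb: "suborb x y \<subseteq> orb y"
  using stabilizer_subset by (force simp: suborb_def orbit_def)

lemma suborb_E: "y \<in> E \<Longrightarrow> z \<in> suborb x y \<Longrightarrow> z \<in> E"
  using suborb_subset_orb orb_subset by blast

lemma suborb_refl: "x \<in> E \<Longrightarrow> y \<in> E \<Longrightarrow> y \<in> suborb x y"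
  using group_action.orbit_refl[OF suborb_action(1)] suborb_action(2) by metis

lemma suborb_closed:
  assumes "x \<in> E" "y \<in> E" "z \<in> suborb x y" "g \<in> Stab x"
  shows "\<phi> g z \<in> suborb x y"
proof -
  obtain h where h: "h \<in> Stab x" "z = \<phi> h y" using assms(3) by (auto simp: suborb_def)
  have "\<phi> g z = \<phi> (g \<otimes> h) y"
    using h assms stabilizer_subset[of x] by (simp add: composition_rule subset_iff)
  then show ?thesis using stabilizer_m_closed[OF assms(1,4) h(1)] by (auto simp: suborb_def)
qed

lemma suborb_eq:
  assumes "x \<in> E" "y \<in> E" "z \<in> suborb x y"
  shows "suborb x z = suborb x y"
proof
  show "suborb x z \<subseteq> suborb x y"
    using suborb_closed[OF assms] by (auto simp: suborb_def[of x z])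
  have zE: "z \<in> E" using suborb_E assms by blast
  have "y \<in> suborb x z"
    using group_action.orbit_sym[OF suborb_action(1)[OF assms(1)] assms(2) zE]
      assms(3) by (simp add: suborb_action(2)[OF assms(1)])
  then show "suborb x y \<subseteq> suborb x z"
    using suborb_closed[OF assms(1) zE] by (auto simp: suborb_def[of x y])
qed

lemma suborb_not_self:
  assumes "x \<in> E" "y \<in> E" "x \<noteq> y"
  shows "x \<notin> suborb x y"
proof
  assume "x \<in> suborb x y"
  then obtain g where g: "g \<in> Stab x" "\<phi> g y = x" by (auto simp: suborb_def)
  then have "\<phi> g x = x" "g \<in> carrier G" by (auto simp: stabilizer_def)
  then show False using inj_prop[of g] g assms by (metis inj_onD)
qed

definition suborb_fixers where
  "suborb_fixers x y = (\<Union>z\<in>suborb x y. Stab x \<inter> Stab z - {\<one>})"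

text \<open>By \<open>Stab_three\<close> the sets in the union are disjoint, and each has f - 1
  elements, with f the order of a two-point stabilizer. The total |O|(f - 1) equals
  |\<open>Stab x\<close>| - |O| for the suborbit O.\<close>

lemma card_suborb_fixers:
  assumes x: "x \<in> E" and y: "y \<in> E" and "x \<noteq> y"
  shows "card (suborb_fixers x y) + card (suborb x y) = card (Stab x)"
proof -
  let ?f = "card (Stab x \<inter> Stab y)"
  have "card (suborb_fixers x y) = (\<Sum>z\<in>suborb x y. card (Stab x \<inter> Stab z - {\<one>}))"
    unfolding suborb_fixers_def
  proof (rule card_UN_disjoint; (intro ballI impI)?)
    fix z w assume zw: "z \<in> suborb x y" "w \<in> suborb x y" "z \<noteq> w"
    then have "z \<in> E" "w \<in> E" "x \<noteq> z" "x \<noteq> w"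
      using suborb_E suborb_not_self assms by auto
    then show "(Stab x \<inter> Stab z - {\<one>}) \<inter> (Stab x \<inter> Stab w - {\<one>}) = {}"
      using Stab_three[OF x, of z w] zw(3) by blast
  qed auto
  also have "\<dots> = (\<Sum>z\<in>suborb x y. ?f - 1)"
  proof (rule sum.cong[OF refl])
    fix z assume z: "z \<in> suborb x y"
    have zE: "z \<in> E" using suborb_E y z by blast
    have "card (suborb x y) * card (Stab x \<inter> Stab z) = card (suborb x y) * ?f"
      using card_suborb[OF x y] card_suborb[OF x zE] suborb_eq[OF x y z] by simp
    moreover have "card (suborb x y) \<noteq> 0" using z by auto
    ultimately have "card (Stab x \<inter> Stab z) = ?f" by simp
    then show "card (Stab x \<inter> Stab z - {\<one>}) = ?f - 1"
      using one_Stab x zE by simp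
  qed
  also have "\<dots> = card (suborb x y) * (?f - 1)" by simp
  moreover have "1 \<le> ?f" using one_Stab[OF x] one_Stab[OF y] by (auto simp: Suc_le_eq card_gt_0_iff)
  ultimately have "card (suborb_fixers x y) + card (suborb x y) = card (suborb x y) * ?f"
    by (metis add.commute le_add_diff_inverse mult.right_neutral distrib_left)
  then show ?thesis using card_suborb[OF x y] by simp
qed

lemma suborb_fixers_subset: "suborb_fixers x y \<subseteq> Stab x - {\<one>}"
  by (auto simp: suborb_fixers_def)

text \<open>Two different suborbits with nontrivial point stabilizers would need at least half of
  the elements of the stabilizer each.\<close>

lemma card_Ker_suborb:
  assumes x: "x \<in> E" and y: "y \<in> E" "x \<noteq> y" and h: "h \<in> Stab x \<inter> Stab y" "h \<noteq> \<one>"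
  shows "Stab x - Ker x = suborb_fixers x y" and "card (Ker x) = card (suborb x y)"
proof -
  \<comment> \<open>A nontrivial k fixing x and w forces two-point stabilizers of order at least 2.
    The suborbit is then at most half of |\<open>Stab x\<close>|, and its fixers number at least
    half.\<close>
  have half: "2 * card (suborb x w) \<le> card (Stab x)"
    if w: "w \<in> E" and k: "k \<in> Stab x \<inter> Stab w" "k \<noteq> \<one>" for w k
  proof -
    have "card {\<one>, k} \<le> card (Stab x \<inter> Stab w)"
      using k one_Stab[OF x] one_Stab[OF w] by (intro card_mono) auto
    then have "2 \<le> card (Stab x \<inter> Stab w)" using k by simp
    then have "card (suborb x w) * 2 \<le> card (suborb x w) * card (Stab x \<inter> Stab w)" by (rule mult_le_mono2)
    then show ?thesis using card_suborb[OF x w] by simp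
  qed
  show eq: "Stab x - Ker x = suborb_fixers x y"
  proof
    show "suborb_fixers x y \<subseteq> Stab x - Ker x"
    proof
      fix g assume "g \<in> suborb_fixers x y"
      then obtain z where z: "z \<in> suborb x y" "g \<in> Stab x" "g \<in> Stab z" "g \<noteq> \<one>"
        by (auto simp: suborb_fixers_def)
      have zE: "z \<in> E" and "z \<noteq> x" using z suborb_E y suborb_not_self[OF x y] by auto
      have gG: "g \<in> carrier G" using z stabilizer_subset by blast
      then have "z \<in> Fix g" using z Fix_iff[OF zE gG] by simp
      then show "g \<in> Stab x - Ker x" using z \<open>z \<noteq> x\<close> by (auto simp: Ker_eq[OF x])
    qed
    show "Stab x - Ker x \<subseteq> suborb_fixers x y"
    proof
      fix g assume g: "g \<in> Stab x - Ker x"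
      then have gG: "g \<in> carrier G" "g \<noteq> \<one>" "Fix g \<noteq> {x}" using stabilizer_subset
        by (auto simp: Ker_eq[OF x])
      moreover have "x \<in> Fix g" using g Fix_iff[OF x gG(1)] by simp
      ultimately obtain w where w: "w \<in> Fix g" "w \<noteq> x" by blast
      have wE: "w \<in> E" using w Fix_subset by blast
      have gw: "g \<in> Stab x \<inter> Stab w" using w g Fix_iff[OF wE gG(1)] by simp
      have gT: "g \<in> suborb_fixers x w"
        using gw gG suborb_refl[OF x wE] by (auto simp: suborb_fixers_def)
      show "g \<in> suborb_fixers x y"
      proof (rule ccontr)
        assume no: "g \<notin> suborb_fixers x y"
        have disj: "suborb_fixers x y \<inter> suborb_fixers x w = {}"
        proof (rule ccontr)
          assume "suborb_fixers x y \<inter> suborb_fixers x w \<noteq> {}"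
          then obtain k u v where k: "k \<noteq> \<one>" "k \<in> Stab x" "k \<in> Stab u" "k \<in> Stab v"
            "u \<in> suborb x y" "v \<in> suborb x w" by (auto simp: suborb_fixers_def)
          then have "u \<in> E" "v \<in> E" "x \<noteq> u" "x \<noteq> v"
            using suborb_E y wE suborb_not_self[OF x y] suborb_not_self[OF x wE] w(2) by auto
          then have "u = v" using Stab_three[OF x, of u v k] k by blast
          then have "suborb x y = suborb x w"
            using suborb_eq[OF x y(1) k(5)] suborb_eq[OF x wE k(6)] by simp
          then show False using no gT by (simp add: suborb_fixers_def)
        qed
        have "card (suborb_fixers x y \<union> suborb_fixers x w) \<le> card (Stab x - {\<one>})"
          using suborb_fixers_subset by (intro card_mono) auto
        moreover have "card (suborb_fixers x y \<union> suborb_fixers x w)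
            = card (suborb_fixers x y) + card (suborb_fixers x w)"
          using disj by (intro card_Un_disjoint) (auto simp: suborb_fixers_def)
        moreover have "card (Stab x - {\<one>}) < card (Stab x)"
          using one_Stab[OF x] by (intro card_Diff1_less) auto
        moreover note card_suborb_fixers[OF x y] card_suborb_fixers[OF x wE w(2)[symmetric]]
          half[OF y(1) h] half[OF wE gw gG(2)]
        ultimately show False by linarith
      qed
    qed
  qed
  have "card (Stab x - Ker x) = card (Stab x) - card (Ker x)"
    using Ker_subset[OF x] finite_Ker[OF x] by (intro card_Diff_subset) auto
  moreover have "card (Ker x) \<le> card (Stab x)" using Ker_subset[OF x] by (intro card_mono) auto
  \<comment> \<open>\<open>Ker x\<close> is the complement of the fixers in \<open>Stab x\<close>,
    so its size is what \<open>card_suborb_fixers\<close> leaves over.\<close>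
  ultimately show "card (Ker x) = card (suborb x y)"
    using card_suborb_fixers[OF x y] unfolding eq by linarith
qed

text \<open>If \<open>Stab x\<close> equals \<open>Ker x\<close>, no second fixed points occur and
  any \<open>y0\<close> has a suborbit of the right length. The last clause lets a caller place
  \<open>y0\<close> in \<Gamma>: if y then falls outside \<Gamma>, its two-point stabilizer with x
  is nontrivial.\<close>

lemma obtain_fixing_suborbit:
  assumes x: "x \<in> E" and y0: "y0 \<in> E" "x \<noteq> y0"
  obtains y where "y \<in> E" "x \<noteq> y" "card (suborb x y) = card (Ker x)"
    and "\<And>g z. g \<in> Stab x \<Longrightarrow> g \<in> Stab z \<Longrightarrow> g \<noteq> \<one> \<Longrightarrow> z \<in> E \<Longrightarrow> z \<noteq> x \<Longrightarrow> z \<in> suborb x y"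
    and "y = y0 \<or> Stab x \<inter> Stab y \<noteq> {\<one>}"
proof (cases "Stab x = Ker x")
  case True
  have triv: False if "g \<in> Stab x" "g \<in> Stab z" "g \<noteq> \<one>" "z \<in> E" "z \<noteq> x" for g z
  proof -
    have gG: "g \<in> carrier G" using that stabilizer_subset by blast
    have "Fix g = {x}" using True that by (auto simp: Ker_eq[OF x])
    then show False using Fix_iff[OF that(4) gG] that by simp
  qed
  have "Stab x \<inter> Stab y0 = {\<one>}"
    using triv[of _ y0] y0 one_Stab[OF x] one_Stab[OF y0(1)] by blast
  then have "card (suborb x y0) = card (Ker x)" using card_suborb[OF x y0(1)] True by simp
  then show thesis using that[of y0] y0 triv by blast
next
  case False
  then obtain g where g: "g \<in> Stab x" "g \<notin> Ker x" using Ker_subset[OF x] by blast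
  then have gG: "g \<in> carrier G" "g \<noteq> \<one>" "Fix g \<noteq> {x}" using stabilizer_subset
    by (auto simp: Ker_eq[OF x])
  moreover have "x \<in> Fix g" using g Fix_iff[OF x gG(1)] by simp
  ultimately obtain y where y: "y \<in> Fix g" "y \<noteq> x" by blast
  have yE: "y \<in> E" using y Fix_subset by blast
  have gy: "g \<in> Stab x \<inter> Stab y" using y g Fix_iff[OF yE gG(1)] by simp
  note K = card_Ker_suborb[OF x yE y(2)[symmetric] gy gG(2)]
  show thesis
  proof (rule that[OF yE y(2)[symmetric] K(2)[symmetric]])
    fix h z assume h: "h \<in> Stab x" "h \<in> Stab z" "h \<noteq> \<one>" "z \<in> E" "z \<noteq> x"
    have hG: "h \<in> carrier G" using h stabilizer_subset by blast
    have "z \<in> Fix h" using Fix_iff[OF h(4) hG] h by simp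
    then have "h \<in> Stab x - Ker x" using h by (auto simp: Ker_eq[OF x])
    then obtain u where u: "u \<in> suborb x y" "h \<in> Stab u"
      unfolding K(1) by (auto simp: suborb_fixers_def)
    have "u \<in> E" "x \<noteq> u" using suborb_E[OF yE] suborb_not_self[OF x yE] y u by auto
    then have "u = z" using Stab_three[OF x, of u z h] h u by blast
    then show "z \<in> suborb x y" using u by simp
  next
    show "y = y0 \<or> Stab x \<inter> Stab y \<noteq> {\<one>}" using gy gG by blast
  qed
qed

end

section \<open>Diophantine analysis of the orders\<close>

text \<open>Here g = |\<Gamma>|, d is the order of a point stabilizer on \<Delta>, and m counts the
  regular suborbits in \<Gamma>. The last hypothesis is |\<Delta>|d = |G|; its left factor is
  divisible by fq, with quotient k + m(fk - 1).\<close>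

lemma kernel_order_arith_A:
  fixes q f k m d g :: nat
  assumes q: "q = 1 + f * k" "3 \<le> q" and g: "g = 1 + q + m * (f * q)"
    and d: "(g * (q - 2) + 2) * d = g * (f * q)"
  shows "m = 0 \<and> (f = q - 1 \<or> 2 * f = q - 1) \<or> m = 1 \<and> f = 2 \<and> q = 3 \<and> d = 5"
proof -
  \<comment> \<open>After cancelling fq, f is nearly a solution for d: the remainder is only 2(1 +
    mf). So the excess T = d - f is the convenient unknown, taken as an integer since its sign is
    not known in advance.\<close>
  define F K M T where "F = int f" and "K = int k" and "M = int m" and "T = int d - int f"
  have fk: "2 \<le> F * K"
  proof -
    have "2 \<le> f * k" using q by simp
    then have "int 2 \<le> int (f * k)" by (rule zle_int[THEN iffD2])
    then show ?thesis by (simp add: F_def K_def)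
  qed
  have F1: "1 \<le> F" and K1: "1 \<le> K" using q by (auto simp: F_def K_def Suc_le_eq intro!: Nat.gr0I)
  have M0: "0 \<le> M" by (simp add: M_def)
  have Q: "int q = 1 + F * K" using q by (simp add: F_def K_def)
  have "int (q - 2) = F * K - 1" using q(2) Q by simp
  moreover have "int ((g * (q - 2) + 2) * d) = int (g * (f * q))" by (simp only: d)
  ultimately have "(int g * (F * K - 1) + 2) * int d = int g * (F * int q)"
    by (simp only: of_nat_mult of_nat_add of_nat_numeral F_def)
  moreover have G: "int g = 1 + int q + M * (F * int q)" using g by (simp add: F_def M_def)
  have "int g * (F * K - 1) + 2 = (F * int q) * (K + M * (F * K - 1))"
    unfolding G Q by (simp add: algebra_simps)
  ultimately have "(F * int q) * ((K + M * (F * K - 1)) * int d) = (F * int q) * int g"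
    by (simp only: mult.assoc mult.commute mult.left_commute)
  moreover have "F * int q \<noteq> 0" using F1 q(2) by simp
  ultimately have "(K + M * (F * K - 1)) * int d = int g" using mult_left_cancel by blast
  moreover have dT: "int d = F + T" by (simp add: T_def F_def)
  ultimately have T: "(K + M * (F * K - 1)) * T = 2 * (1 + M * F)"
    unfolding G Q by (simp add: algebra_simps)
  have MF: "M \<le> M * F" using M0 F1 mult_left_mono[of 1 F M] by simp
  have "0 < T"
  proof -
    have "0 < K + M * (F * K - 1)" using K1 M0 fk by (simp add: add_pos_nonneg)
    moreover have "0 < (K + M * (F * K - 1)) * T" unfolding T using MF M0 by simp
    ultimately show ?thesis using zero_less_mult_pos by blast
  qed
  \<comment> \<open>Regrouped so that M = 0 reads TK = 2, and M > 0 forces TK > 2.\<close>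
  have E: "(T * K - 2) * (1 + M * F) = T * M" using T by (simp add: algebra_simps)
  show ?thesis
  proof (cases "m = 0")
    case True
    then have "T * K = 2" using E by (simp add: M_def)
    then have "K dvd 2" by (metis dvd_triv_right)
    then have "K \<le> 2" by (simp add: zdvd_imp_le)
    then have "k = 1 \<or> k = 2" using K1 by (auto simp: K_def)
    then show ?thesis using True q by auto
  next
    case False
    then have M1: "1 \<le> M" by (simp add: M_def)
    have TM: "0 < T * M" using \<open>0 < T\<close> M1 by simp
    have pos: "0 < T * K - 2"
    proof (rule ccontr)
      assume "\<not> 0 < T * K - 2"
      then have "(T * K - 2) * (1 + M * F) \<le> 0" using MF M0 by (simp add: mult_nonpos_nonneg)
      then show False using E TM by simp
    qed
    \<comment> \<open>For K at least 2 the factor TK - 2 is at least T, and cancelling T in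
      \<open>E\<close> leaves the impossible 1 + MF \<le> M.\<close>
    have "K = 1"
    proof (rule ccontr)
      assume "K \<noteq> 1"
      then have "2 \<le> K" using K1 by simp
      then have "T * 2 \<le> T * K" using \<open>0 < T\<close> by simp
      then have "T \<le> T * K - 2 \<or> T = 1" using \<open>0 < T\<close> by linarith
      then have "T \<le> T * K - 2" using pos by auto
      then have "T * (1 + M * F) \<le> (T * K - 2) * (1 + M * F)"
        using MF M0 by (intro mult_right_mono) auto
      then have "T * (1 + M * F) \<le> T * M" using E by simp
      then have "1 + M * F \<le> M" using \<open>0 < T\<close> by simp
      then show False using MF by simp
    qed
    then have F2: "2 \<le> F" using fk by simp
    have E': "(T - 2) * (1 + M * F) = T * M" and T3: "3 \<le> T" using E pos \<open>K = 1\<close> by simp_all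
    \<comment> \<open>With F at least 2, \<open>E'\<close> bounds T below 4, so T = 3. Then M(3 - F)
      = 1 gives M = 1 and F = 2.\<close>
    have "M * 2 \<le> M * F" using F2 M1 by simp
    then have "(T - 2) * (1 + M * 2) \<le> T * M"
      using T3 unfolding E'[symmetric] by (intro mult_left_mono) auto
    then have "T * (1 + M) \<le> 2 + 4 * M" by (simp add: algebra_simps)
    moreover have "4 * (1 + M) \<le> T * (1 + M)" if "4 \<le> T"
      using that M1 by (intro mult_right_mono) auto
    ultimately have "T < 4" by (cases "4 \<le> T") auto
    then have "T = 3" using T3 by simp
    then have "M * (3 - F) = 1" using E' by (simp add: algebra_simps)
    then have "M = 1" "3 - F = 1" using M1 zmult_eq_1_iff by auto
    then show ?thesis using \<open>K = 1\<close> \<open>T = 3\<close> q by (simp add: M_def F_def K_def T_def)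
  qed
qed

text \<open>The case of a fixing suborbit outside \<Gamma>. Here |\<Delta>| = qD with D = 1 + mf(q -
  2), and D divides f(D + 2mf). As D is coprime to f and to mf, it divides 2, yet it is at least
  3.\<close>

lemma kernel_order_arith_B:
  fixes q f k m d g :: nat
  assumes q: "q = 1 + f * k" "3 \<le> q" "2 \<le> f" and g: "g = 1 + m * (f * q)" "1 \<le> m"
    and d: "(g * (q - 2) + 2) * d = g * (f * q)"
  shows False
proof -
  define r where "r = q - 2"
  then have r: "q = r + 2" "1 \<le> r" using q(2) by auto
  define D where "D = 1 + m * f * r"
  have "g * (q - 2) + 2 = q * D" unfolding g D_def r by (simp add: algebra_simps)
  then have "q * (D * d) = q * (f * g)" using d by (simp add: ac_simps)
  then have Dd: "D * d = f * g" using q(2) by simp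
  have "f * g = f * (D + 2 * (m * f))" unfolding g D_def r by (simp add: algebra_simps)
  then have "D dvd f * (D + 2 * (m * f))" using Dd by (metis dvd_triv_left)
  moreover have cop: "coprime (1 + b * a) b" for a b :: nat
    by (rule coprimeI) (metis dvd_add_left_iff dvd_mult2)
  have "D = 1 + f * (m * r)" "D = 1 + (m * f) * r" by (simp_all add: D_def)
  then have "coprime D f" "coprime D (m * f)" using cop by metis+
  ultimately have "D dvd D + 2 * (m * f)" using coprime_dvd_mult_right_iff by blast
  then have "D dvd 2 * (m * f)" by (simp add: dvd_add_right_iff)
  then have "D dvd 2" using \<open>coprime D (m * f)\<close> coprime_dvd_mult_left_iff by blast
  then have "D \<le> 2" by (simp add: dvd_imp_le)
  moreover have "1 * 2 * 1 \<le> m * f * r" using q g r by (intro mult_le_mono) auto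
  ultimately show False by (simp add: D_def)
qed

section \<open>Locating the fixing suborbit\<close>

context few_fixed_points
begin

lemma obtain_suborbit_in_Gam:
  assumes x: "x \<in> Gam" and D: "NR - {Gam} = {D}"
  obtains y where "y \<in> Gam" "x \<noteq> y" "card (suborb x y) = card (Ker x)" "3 \<le> card (Ker x)"
    and "\<forall>g\<in>Stab x - {\<one>}. \<forall>z\<in>E - {x}. g \<in> Stab z \<longrightarrow> z \<in> suborb x y"
    and "card Gam = card (Ker x) + 1 \<and>
          (card (Stab x \<inter> Stab y) = card (Ker x) - 1 \<or> 2 * card (Stab x \<inter> Stab y) = card (Ker x) - 1)
        \<or> card Gam = 10 \<and> card (Ker x) = 3 \<and> card (Stab x \<inter> Stab y) = 2 \<and> (\<forall>z\<in>D. card (Stab z) = 5)"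
proof -
  have xE: "x \<in> E" using x by (rule Gam_E)
  have Gam_x: "orb x = Gam" using two_nonregular_orbits(1)[OF x] .
  have finGam: "finite Gam" using finite_orb[of x] Gam_x by simp
  have Gam3: "3 \<le> card Gam" using card_orb[OF xE] Gam_x by simp
  have "D \<in> NR" "D \<noteq> Gam" using D by auto
  then obtain d where d: "d \<in> moved" "D = orb d" "D \<noteq> Gam" unfolding NR_eq by auto
  have dE: "d \<in> E" using d by (simp add: moved_def)
  define q where "q = card (Ker x)"
  define g where "g = card Gam"
  obtain D' where D': "NR - {Gam} = {D'}" "\<forall>x\<in>Gam. card D' = card Gam * (card (Ker x) - 2) + 2"
    using two_nonregular_orbits(3) by blast
  then have "D' = D" using D by simp
  then have cD: "card D = g * (q - 2) + 2" using D'(2) x by (simp add: q_def g_def)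
  have "2 \<le> q" using Gam_iff[OF xE] x by (simp add: q_def)
  moreover have "3 \<le> card D" using card_orb[OF dE] d by simp
  \<comment> \<open>For q = 2 the formula would give |\<Delta>| = 2, too short for an orbit.\<close>
  ultimately have q3: "3 \<le> q" using cD by (cases "q = 2") auto
  have "\<not> Gam \<subseteq> {x}" using card_mono[of "{x}" Gam] Gam3 by auto
  then obtain y0 where y0: "y0 \<in> Gam" "x \<noteq> y0" by blast
  obtain y where y: "y \<in> E" "x \<noteq> y" "card (suborb x y) = card (Ker x)"
    and fixers: "\<And>g z. g \<in> Stab x \<Longrightarrow> g \<in> Stab z \<Longrightarrow> g \<noteq> \<one> \<Longrightarrow> z \<in> E \<Longrightarrow> z \<noteq> x \<Longrightarrow> z \<in> suborb x y"
    and y0y: "y = y0 \<or> Stab x \<inter> Stab y \<noteq> {\<one>}"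
    using obtain_fixing_suborbit[OF xE Gam_E[OF y0(1)] y0(2)] by metis
  define F where "F = card (Stab x \<inter> Stab y)"
  have F: "card (Stab x) = F * q" using card_suborb[OF xE y(1)] y(3) by (simp add: F_def q_def mult.commute)
  have d_eq: "(g * (q - 2) + 2) * card (Stab d) = g * (F * q)"
    using orbit_stabilizer_theorem[OF dE] orbit_stabilizer_theorem[OF xE]
    unfolding Gam_x F d(2)[symmetric] cD g_def[symmetric] by simp
  \<comment> \<open>A nontrivial element fixing x and y fixes nothing else, so the two-point
    stabilizer acts semiregularly on the rest of the suborbit.\<close>
  have "F dvd card (suborb x y - {y})"
    unfolding F_def
  proof (rule semiregular_card_dvd)
    show "subgroup (Stab x \<inter> Stab y) G"
      using subgroups_Inter_pair stabilizer_subgroup xE y by blast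
    show "suborb x y - {y} \<subseteq> E" using suborb_E y by blast
    fix s z assume s: "s \<in> Stab x \<inter> Stab y" and z: "z \<in> suborb x y - {y}"
    have zE: "z \<in> E" using z suborb_E y by blast
    have sG: "s \<in> carrier G" "\<phi> s y = y" using s by (auto simp: stabilizer_def)
    have "\<phi> s z \<noteq> y" using inj_prop[OF sG(1)] sG(2) zE y(1) z by (metis DiffD2 inj_onD singletonI)
    then show "\<phi> s z \<in> suborb x y - {y}" using suborb_closed[OF xE y(1)] z s by blast
    assume "\<phi> s z = z"
    then have "s \<in> Stab z" using sG by (simp add: stabilizer_def)
    then show "s = \<one>" using Stab_three[OF xE y(1) zE, of s] y z s suborb_not_self[OF xE y(1,2)] by blast
  qed auto
  moreover have "card (suborb x y - {y}) = q - 1" using suborb_refl[OF xE y(1)] y by (simp add: q_def)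
  ultimately obtain k where "q - 1 = F * k" by (metis dvdE)
  then have k: "q = 1 + F * k" using q3 by linarith
  have Gam_closed: "\<phi> s z \<in> Gam - {x}" if "s \<in> Stab x" "z \<in> Gam - {x}" for s z
  proof -
    have sG: "s \<in> carrier G" "\<phi> s x = x" and zE: "z \<in> E"
      using that Gam_E by (auto simp: stabilizer_def)
    have "\<phi> s z \<noteq> x" using inj_prop[OF sG(1)] sG(2) zE xE that(2) by (metis DiffD2 inj_onD singletonI)
    moreover have "\<phi> s z \<in> orb z" using sG by (auto simp: orbit_def)
    ultimately show ?thesis using two_nonregular_orbits(1)[of z] that by auto
  qed
  \<comment> \<open>All second fixed points lie in \<open>suborb x y\<close>, so
    \<open>Stab x\<close> is semiregular on any invariant set avoiding x and that suborbit. The set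
    is kept general because the suborbit is removed from \<Gamma> only when it lies there.\<close>
  have semireg: "card (Stab x) dvd card X"
    if X: "X \<subseteq> Gam - {x}" "X \<inter> suborb x y = {}" "\<And>s z. s \<in> Stab x \<Longrightarrow> z \<in> X \<Longrightarrow> \<phi> s z \<in> X" for X
  proof (rule semiregular_card_dvd)
    show "subgroup (Stab x) G" using stabilizer_subgroup xE by blast
    show "finite X" using X(1) finGam finite_subset by blast
    show XE: "X \<subseteq> E" using X(1) Gam_E by blast
    fix s z assume s: "s \<in> Stab x" and z: "z \<in> X" and "\<phi> s z = z"
    then have "s \<in> Stab z" by (auto simp: stabilizer_def)
    then show "s = \<one>" using fixers[OF s, of z] z XE X by blast
  qed (use X in auto)
  show thesis
  proof (cases "y \<in> Gam")
    case True
    have sub: "suborb x y \<subseteq> Gam - {x}"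
      using suborb_subset_orb[of x y] two_nonregular_orbits(1)[OF True] suborb_not_self[OF xE y(1,2)] by blast
    have "card (Stab x) dvd card (Gam - {x} - suborb x y)"
    proof (rule semireg)
      fix s z assume s: "s \<in> Stab x" and z: "z \<in> Gam - {x} - suborb x y"
      have zE: "z \<in> E" using z Gam_E by blast
      have "\<phi> s z \<notin> suborb x y"
      proof
        assume "\<phi> s z \<in> suborb x y"
        moreover have "\<phi> s z \<in> suborb x z" using s by (simp add: suborb_def)
        moreover note suborb_E[OF y(1)]
        ultimately have "suborb x z = suborb x y" using suborb_eq[OF xE zE] suborb_eq[OF xE y(1)] by metis
        then show False using z suborb_refl[OF xE zE] by simp
      qed
      then show "\<phi> s z \<in> Gam - {x} - suborb x y" using Gam_closed s z by blast
    qed auto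
    moreover have "card (Gam - {x} - suborb x y) = g - 1 - q"
      using card_Diff_subset[OF _ sub] x finGam y(3) by (simp add: g_def q_def)
    \<comment> \<open>Makes g - 1 - q a genuine difference, so that its being a multiple of Fq can
      be solved for g.\<close>
    moreover have "q \<le> g - 1"
      using card_mono[OF _ sub] finGam x y(3) by (simp add: g_def q_def)
    moreover obtain m where "g - 1 - q = m * (F * q)"
      using calculation(1,2) F by (metis dvdE mult.commute)
    moreover have "3 \<le> g" using Gam3 by (simp add: g_def)
    ultimately have m: "g = 1 + q + m * (F * q)" by linarith
    have "m = 0 \<and> (F = q - 1 \<or> 2 * F = q - 1) \<or> m = 1 \<and> F = 2 \<and> q = 3 \<and> card (Stab d) = 5"
      by (rule kernel_order_arith_A[OF k q3 m d_eq])
    moreover have "card (Stab z) = card (Stab d)" if "z \<in> D" for z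
      using card_Stab_orb[OF dE] that d by simp
    ultimately have "g = q + 1 \<and> (F = q - 1 \<or> 2 * F = q - 1) \<or>
        g = 10 \<and> q = 3 \<and> F = 2 \<and> (\<forall>z\<in>D. card (Stab z) = 5)"
      using m by auto
    then have alt: "card Gam = card (Ker x) + 1 \<and>
          (card (Stab x \<inter> Stab y) = card (Ker x) - 1 \<or> 2 * card (Stab x \<inter> Stab y) = card (Ker x) - 1)
        \<or> card Gam = 10 \<and> card (Ker x) = 3 \<and> card (Stab x \<inter> Stab y) = 2 \<and> (\<forall>z\<in>D. card (Stab z) = 5)"
      unfolding g_def q_def F_def by blast
    show thesis
      by (rule that[OF True y(2,3) _ _ alt]) (use q3 fixers in \<open>auto simp: q_def\<close>)
  next
    case False
    \<comment> \<open>Since y is outside \<Gamma> it cannot be \<open>y0\<close>; this yields F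
      \<ge> 2 for the second arithmetic lemma.\<close>
    then have "Stab x \<inter> Stab y \<noteq> {\<one>}" using y0y y0 by blast
    then have "F \<noteq> 1" using one_Stab[OF xE] one_Stab[OF y(1)] unfolding F_def
      by (metis IntI card_1_singletonE singletonD)
    moreover have "F \<noteq> 0" using one_Stab[OF xE] one_Stab[OF y(1)] by (auto simp: F_def)
    ultimately have F2: "2 \<le> F" by simp
    have "suborb x y \<inter> Gam = {}"
      using Gam_orb[OF y(1)] False suborb_subset_orb by blast
    then have "card (Stab x) dvd card (Gam - {x})" using Gam_closed by (intro semireg) auto
    then have "F * q dvd g - 1" using F x finGam by (simp add: g_def)
    then obtain m where m: "g - 1 = m * (F * q)" by (metis dvdE mult.commute)
    then have "g = 1 + m * (F * q)" "1 \<le> m" using Gam3 by (cases "m = 0"; simp add: g_def)+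
    then show thesis using kernel_order_arith_B[OF k q3 F2 _ _ d_eq] by blast
  qed
qed

section \<open>2-transitivity, point stabilizers of order six, centralizers\<close>

text \<open>Each of the two pairs is pulled back to a pair starting with x, and
  \<open>Stab x\<close> matches the second entries; the required element is h k g^-1.\<close>

lemma two_transitive_Gam:
  assumes x: "x \<in> Gam" and y: "Gam - {x} \<subseteq> suborb x y" "y \<in> E"
  shows "two_transitive_on G \<phi> Gam"
proof -
  have xE: "x \<in> E" using x by (rule Gam_E)
  have to_x: "\<exists>g\<in>carrier G. \<phi> g x = a" if "a \<in> Gam" for a
  proof -
    have "a \<in> orb x" using that two_nonregular_orbits(1)[OF x] by simp
    then show ?thesis by (auto simp: orbit_def)
  qed
  have stab: "\<exists>h\<in>carrier G. \<phi> h x = x \<and> \<phi> h u = v" if uv: "u \<in> Gam - {x}" "v \<in> Gam - {x}" for u v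
  proof -
    have "suborb x u = suborb x y" using suborb_eq[OF xE y(2)] uv y by blast
    then have "v \<in> suborb x u" using uv y by blast
    then show ?thesis by (auto simp: suborb_def stabilizer_def)
  qed
  have pull: "\<exists>g\<in>carrier G. \<exists>u\<in>Gam - {x}. \<phi> g x = a \<and> \<phi> g u = b"
    if ab: "a \<in> Gam" "b \<in> Gam" "a \<noteq> b" for a b
  proof -
    obtain g where g: "g \<in> carrier G" "\<phi> g x = a" using to_x ab by blast
    have bE: "b \<in> E" and aE: "a \<in> E" using ab Gam_E by auto
    define u where "u = \<phi> (inv g) b"
    have gu: "\<phi> g u = b" using orbit_sym_aux[of "inv g" b u] g bE by (simp add: u_def)
    have "u \<in> orb b" using g by (auto simp: u_def orbit_def)
    then have "u \<in> Gam" using Gam_orb[OF bE] ab by blast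
    moreover have "u \<noteq> x" using gu g ab by auto
    ultimately show ?thesis using g gu by blast
  qed
  show ?thesis
    unfolding two_transitive_on_def
  proof (intro ballI impI)
    fix a b c d assume *: "a \<in> Gam" "b \<in> Gam" "c \<in> Gam" "d \<in> Gam" "a \<noteq> b" "c \<noteq> d"
    obtain g u where g: "g \<in> carrier G" "u \<in> Gam - {x}" "\<phi> g x = a" "\<phi> g u = b"
      using pull[of a b] * by blast
    obtain h v where h: "h \<in> carrier G" "v \<in> Gam - {x}" "\<phi> h x = c" "\<phi> h v = d"
      using pull[of c d] * by blast
    obtain k where k: "k \<in> carrier G" "\<phi> k x = x" "\<phi> k u = v" using stab g h by blast
    have E: "a \<in> E" "b \<in> E" "u \<in> E" using * g Gam_E by auto
    have "\<phi> (inv g) a = x" "\<phi> (inv g) b = u"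
      using orbit_sym_aux[OF g(1) xE g(3)] orbit_sym_aux[OF g(1) E(3) g(4)] .
    then have "\<phi> (h \<otimes> (k \<otimes> inv g)) a = c" "\<phi> (h \<otimes> (k \<otimes> inv g)) b = d"
      using g h k E by (simp_all add: composition_rule)
    then show "\<exists>g\<in>carrier G. \<phi> g a = c \<and> \<phi> g b = d" using g h k by blast
  qed
qed

text \<open>An element of \<open>Stab x\<close> trivial on the suborbit fixes at least three points,
  so the action on it is faithful, and 6 = 3! makes it onto.\<close>

lemma Stab_iso_sym_group_3:
  assumes x: "x \<in> E" and y: "y \<in> E" "x \<noteq> y" "card (suborb x y) = 3" and "card (Stab x) = 6"
  shows "G\<lparr>carrier := Stab x\<rparr> \<cong> sym_group 3"
proof -
  let ?S = "G\<lparr>carrier := Stab x\<rparr>"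
  interpret S: group ?S using stabilizer_subgroup[OF x] subgroup_imp_group by blast
  obtain f where f: "f \<in> hom ?S (sym_group (card (suborb x y)))" "inj_on f (carrier ?S)"
  proof (rule S.embed_into_sym_group[where a = \<phi> and S = "suborb x y"])
    show "finite (suborb x y)" by simp
    show "\<phi> g z \<in> suborb x y" if "g \<in> carrier ?S" "z \<in> suborb x y" for g z
      using suborb_closed[OF x y(1)] that by simp
    show "\<phi> \<one>\<^bsub>?S\<^esub> z = z" if "z \<in> suborb x y" for z
      using one_Stab[OF suborb_E[OF y(1) that]] by (simp add: stabilizer_def)
    show "\<phi> (g \<otimes>\<^bsub>?S\<^esub> h) z = \<phi> g (\<phi> h z)"
      if "g \<in> carrier ?S" "h \<in> carrier ?S" "z \<in> suborb x y" for g h z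
      using that composition_rule[OF suborb_E[OF y(1) that(3)], of g h] stabilizer_subset[of x] by auto
    fix g assume g: "g \<in> carrier ?S" and fix_all: "\<And>z. z \<in> suborb x y \<Longrightarrow> \<phi> g z = z"
    have "\<not> suborb x y \<subseteq> {y}" using card_mono[of "{y}" "suborb x y"] y(3) by auto
    then obtain z where z: "z \<in> suborb x y" "z \<noteq> y" by blast
    have gS: "g \<in> Stab x" "g \<in> Stab y" "g \<in> Stab z"
      using g fix_all z suborb_refl[OF x y(1)] stabilizer_subset[of x] by (auto simp: stabilizer_def)
    have "z \<in> E" "x \<noteq> z" using suborb_E y z suborb_not_self[OF x y(1,2)] by auto
    then show "g = \<one>\<^bsub>?S\<^esub>" using Stab_three[OF x y(1) _ y(2)] gS z by simp
  qed (rule that)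
  then have f: "f \<in> hom ?S (sym_group 3)" "inj_on f (Stab x)" using y(3) by simp_all
  have "f ` Stab x \<subseteq> carrier (sym_group 3)" using f(1) by (auto simp: hom_def)
  moreover have "card (carrier (sym_group 3)) = 6"
    by (simp add: sym_group_card_carrier fact_numeral)
  moreover have "card (f ` Stab x) = 6" using card_image[OF f(2)] assms by simp
  ultimately have "f ` Stab x = carrier (sym_group 3)"
    by (metis card_subset_eq card_ge_0_finite zero_less_numeral)
  then have "f \<in> iso ?S (sym_group 3)" using f by (simp add: iso_def bij_betw_def)
  then show ?thesis by (rule is_isoI)
qed

text \<open>Outside the kernel a point stabilizer of order six consists of involutions, so its
  Sylow 3-subgroup is the kernel.\<close>

lemma Ker_subgroup_order_3:
  assumes x: "x \<in> E" and "card (Stab x) = 6" "card (Ker x) = 3"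
    and inv: "\<And>g. g \<in> Stab x - Ker x \<Longrightarrow> g \<otimes> g = \<one>"
  shows "subgroup (Ker x) G"
proof -
  let ?S = "G\<lparr>carrier := Stab x\<rparr>"
  interpret S: group ?S using stabilizer_subgroup[OF x] subgroup_imp_group by blast
  have "sylow ?S 3 1 2"
    using assms S.group_axioms by (simp add: sylow_eq sylow_axioms_def order_def)
  then obtain H where H: "subgroup H ?S" "card H = 3" using sylow.sylow_thm by fastforce
  have HG: "subgroup H G" using incl_subgroup[OF stabilizer_subgroup[OF x] H(1)] .
  have HS: "H \<subseteq> Stab x" using subgroup.subset[OF H(1)] by simp
  have "H \<subseteq> Ker x"
  proof
    fix h assume h: "h \<in> H"
    have hG: "h \<in> carrier G" using subgroup.mem_carrier[OF HG h] .
    have h3: "h \<otimes> h \<otimes> h = \<one>"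
      using subgroup_pow_card_eq_one[OF HG fin h] H(2) hG by (simp add: numeral_3_eq_3)
    show "h \<in> Ker x"
    proof (rule ccontr)
      assume "h \<notin> Ker x"
      then have "h \<otimes> h = \<one>" using inv h HS by blast
      then have "h = \<one>" using h3 hG by simp
      then show False using \<open>h \<notin> Ker x\<close> Ker_eq[OF x] by simp
    qed
  qed
  then have "H = Ker x" using finite_Ker[OF x] H(2) assms(3) card_subset_eq by metis
  then show ?thesis using HG by simp
qed

text \<open>The centralizer permutes the two fixed points of t, and whatever fixes one of them fixes
  the other.\<close>

lemma card_centralizer_le:
  assumes t: "t \<in> carrier G" and F: "Fix t = {a, b}" "a \<noteq> b"
  shows "card {g \<in> carrier G. g \<otimes> t = t \<otimes> g} \<le> 2 * card (Stab a \<inter> Stab b)"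
proof -
  let ?C = "{g \<in> carrier G. g \<otimes> t = t \<otimes> g}"
  interpret C: group_action "G\<lparr>carrier := ?C\<rparr>" E \<phi>
    using induced_action centralizer_subgroup t by blast
  have ab: "a \<in> E" "b \<in> E" using F Fix_subset by blast+
  have img: "\<phi> g ` {a, b} = {a, b}" if "g \<in> ?C" for g
  proof -
    have "\<phi> g ` Fix t = Fix t" using Fix_conj[of g t] conj_eq_self_iff[of g t] that t by simp
    then show ?thesis unfolding F(1) .
  qed
  have orb: "orbit (G\<lparr>carrier := ?C\<rparr>) \<phi> a \<subseteq> {a, b}"
    using img by (auto simp: orbit_def)
  have "stabilizer (G\<lparr>carrier := ?C\<rparr>) \<phi> a \<subseteq> Stab a \<inter> Stab b"
  proof
    fix g assume "g \<in> stabilizer (G\<lparr>carrier := ?C\<rparr>) \<phi> a"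
    then have g: "g \<in> ?C" "\<phi> g a = a" by (auto simp: stabilizer_def)
    have "\<phi> g b \<in> {a, b}" using img[OF g(1)] by blast
    moreover have "\<phi> g b \<noteq> \<phi> g a" using inj_prop[of g] g ab F(2) by (metis (no_types, lifting) inj_onD mem_Collect_eq)
    ultimately show "g \<in> Stab a \<inter> Stab b" using g by (auto simp: stabilizer_def)
  qed
  then have "card (stabilizer (G\<lparr>carrier := ?C\<rparr>) \<phi> a) \<le> card (Stab a \<inter> Stab b)"
    by (intro card_mono) auto
  moreover have "card (orbit (G\<lparr>carrier := ?C\<rparr>) \<phi> a) \<le> 2"
    using card_mono[OF _ orb] F(2) by simp
  ultimately have "card (orbit (G\<lparr>carrier := ?C\<rparr>) \<phi> a) * card (stabilizer (G\<lparr>carrier := ?C\<rparr>) \<phi> a)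
      \<le> 2 * card (Stab a \<inter> Stab b)"
    by (intro mult_le_mono)
  then show ?thesis unfolding C.orbit_stabilizer_theorem[OF ab(1)] by (simp add: order_def)
qed

section \<open>The exceptional case\<close>

text \<open>The sizes 10 and 3 contradict |\<Gamma>| = q + 1, so the sporadic alternative holds at
  every point of \<Gamma>. An element outside \<open>Ker x\<close> has its second fixed point in the
  suborbit of y, hence lies in a two-point stabilizer of order 2.\<close>

lemma exceptional_point_stabilizer:
  assumes D: "NR - {Gam} = {D}" and Gam10: "card Gam = 10"
    and Ker3: "\<forall>x\<in>Gam. card (Ker x) = 3" and x: "x \<in> Gam"
  shows "card (Stab x) = 6" and "\<exists>y\<in>Gam. x \<noteq> y \<and> card (suborb x y) = 3"
    and "\<forall>z\<in>D. card (Stab z) = 5"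
    and "\<And>g. g \<in> Stab x - Ker x \<Longrightarrow>
          g \<otimes> g = \<one> \<and> (\<exists>z\<in>Gam. x \<noteq> z \<and> Fix g = {x, z} \<and> card (Stab x \<inter> Stab z) = 2)"
proof -
  have xE: "x \<in> E" using x by (rule Gam_E)
  obtain y where y: "y \<in> Gam" "x \<noteq> y" "card (suborb x y) = card (Ker x)" and "3 \<le> card (Ker x)"
    and fixers: "\<forall>g\<in>Stab x - {\<one>}. \<forall>z\<in>E - {x}. g \<in> Stab z \<longrightarrow> z \<in> suborb x y"
    and alt: "card Gam = card (Ker x) + 1 \<and>
          (card (Stab x \<inter> Stab y) = card (Ker x) - 1 \<or> 2 * card (Stab x \<inter> Stab y) = card (Ker x) - 1)
        \<or> card Gam = 10 \<and> card (Ker x) = 3 \<and> card (Stab x \<inter> Stab y) = 2 \<and> (\<forall>z\<in>D. card (Stab z) = 5)"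
    by (rule obtain_suborbit_in_Gam[OF x D])
  have yE: "y \<in> E" using y(1) by (rule Gam_E)
  have f: "card (Stab x \<inter> Stab y) = 2" and D5: "\<forall>z\<in>D. card (Stab z) = 5"
    using alt Gam10 Ker3[rule_format, OF x] by auto
  have O3: "card (suborb x y) = 3" using y(3) Ker3[rule_format, OF x] by simp
  show "\<forall>z\<in>D. card (Stab z) = 5" by (rule D5)
  show S6: "card (Stab x) = 6" using card_suborb[OF xE yE] f O3 by simp
  show "\<exists>y\<in>Gam. x \<noteq> y \<and> card (suborb x y) = 3" using y O3 by blast
  fix g assume g: "g \<in> Stab x - Ker x"
  have gS: "g \<in> Stab x" using g by simp
  then have gG: "g \<in> carrier G" using stabilizer_subset by blast
  have g1: "g \<noteq> \<one>" "Fix g \<noteq> {x}" using g gG by (auto simp: Ker_eq[OF xE])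
  have "x \<in> Fix g" using gS Fix_iff[OF xE gG] by simp
  then obtain z where z: "z \<in> Fix g" "z \<noteq> x" using g1(2) by blast
  have zE: "z \<in> E" using z Fix_subset by blast
  have gz: "g \<in> Stab z" using z Fix_iff[OF zE gG] by simp
  have zO: "z \<in> suborb x y" using fixers gS gz g1(1) zE z(2) by blast
  then have "z \<in> orb y" using suborb_subset_orb by blast
  then have zG: "z \<in> Gam" using two_nonregular_orbits(1)[OF y(1)] by simp
  have "card (suborb x z) = 3" using suborb_eq[OF xE yE zO] O3 by simp
  then have f2: "card (Stab x \<inter> Stab z) = 2" using card_suborb[OF xE zE] S6 by simp
  have "subgroup (Stab x \<inter> Stab z) G"
    using subgroups_Inter_pair[OF stabilizer_subgroup[OF xE] stabilizer_subgroup[OF zE]] .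
  then have "g [^] card (Stab x \<inter> Stab z) = \<one>"
    using gS gz fin by (intro subgroup_pow_card_eq_one) auto
  then have "g \<otimes> g = \<one>" using f2 gG by (simp add: numeral_2_eq_2)
  moreover have "Fix g = {x, z}" using Fix_eq_two[OF gG g1(1) \<open>x \<in> Fix g\<close> z(1)] z(2) by simp
  ultimately show "g \<otimes> g = \<one> \<and> (\<exists>z\<in>Gam. x \<noteq> z \<and> Fix g = {x, z} \<and> card (Stab x \<inter> Stab z) = 2)"
    using zG z(2) f2 by auto
qed

lemma exceptional_iso_alt_group_5:
  assumes D: "NR - {Gam} = {D}" and Gam10: "card Gam = 10"
    and Ker3: "\<forall>x\<in>Gam. card (Ker x) = 3"
  shows "G \<cong> alt_group 5"
proof -
  note S = exceptional_point_stabilizer[OF D Gam10 Ker3]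
  obtain x0 where x0: "x0 \<in> Gam" using ex_Gam by blast
  have finGam: "finite Gam" using Gam10 by (simp add: card_ge_0_finite)
  have order: "order G = 60"
    using orbit_stabilizer_theorem[OF Gam_E[OF x0]] two_nonregular_orbits(1)[OF x0] Gam10 S(1)[OF x0] by simp
  define I where "I = {x \<in> carrier G. x \<noteq> \<one> \<and> x \<otimes> x = \<one>}"
  have pow3: "g \<otimes> g \<otimes> g = \<one>" if "x \<in> Gam" "g \<in> Ker x" for x g
  proof -
    have xE: "x \<in> E" using that(1) by (rule Gam_E)
    have "subgroup (Ker x) G"
      using Ker_subgroup_order_3[OF xE S(1)[OF that(1)] Ker3[rule_format, OF that(1)]] S(4)[OF that(1)] by blast
    from subgroup_pow_card_eq_one[OF this fin that(2)] show ?thesis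
      using that(2) Ker3[rule_format, OF that(1)] by (simp add: Ker_eq[OF xE] numeral_3_eq_3)
  qed
  have pow5: "g \<otimes> g \<otimes> g \<otimes> g \<otimes> g = \<one>" if "x \<in> D" "x \<in> E" "g \<in> Stab x" for x g
  proof -
    have "card (Stab x) = 5" using S(3)[OF x0] that(1) by blast
    moreover have "g \<in> carrier G" using that(3) stabilizer_subset by blast
    ultimately show ?thesis
      using subgroup_pow_card_eq_one[OF stabilizer_subgroup[OF that(2)] fin that(3)]
      by (simp add: numeral_eq_Suc)
  qed
  have moved_D: "x \<in> D" if "x \<in> moved" "x \<notin> Gam" for x
  proof -
    have "orb x \<in> NR" using that by (simp add: NR_eq)
    moreover have "x \<in> orb x" using that orbit_refl by (simp add: moved_def)
    ultimately have "orb x \<in> NR - {Gam}" using that by auto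
    then show ?thesis using D \<open>x \<in> orb x\<close> by simp
  qed
  \<comment> \<open>Every nontrivial element fixes a point of \<Gamma> or \<Delta>, where the
    kernels have order 3 and the stabilizers order 5 respectively.\<close>
  have cases: "(\<exists>x\<in>Gam. g \<in> Stab x - Ker x) \<or> g \<otimes> g \<otimes> g = \<one> \<or> g \<otimes> g \<otimes> g \<otimes> g \<otimes> g = \<one>"
    if g: "g \<in> carrier G" "g \<noteq> \<one>" for g
  proof -
    have "card (Fix g) \<noteq> 0" using fixed[OF g] by auto
    then have "Fix g \<noteq> {}" by auto
    then obtain x where x: "x \<in> Fix g" by blast
    have xE: "x \<in> E" using x Fix_subset by blast
    have xm: "x \<in> moved" using x Fix_moved[OF g] by blast
    have gS: "g \<in> Stab x" using x Fix_iff[OF xE g(1)] by simp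
    show ?thesis
    proof (cases "x \<in> Gam")
      case True
      then show ?thesis using pow3[OF True, of g] gS by blast
    next
      case False
      then show ?thesis using pow5[OF moved_D[OF xm False] xE gS] by blast
    qed
  qed
  have sq_of_pow4: "g \<otimes> g = \<one>"
    if g: "g \<in> carrier G" and g4: "(g \<otimes> g) \<otimes> (g \<otimes> g) = \<one>" for g
  proof (cases "g = \<one>")
    case False
    from cases[OF g False] show ?thesis
    proof (elim disjE bexE)
      fix x assume "x \<in> Gam" "g \<in> Stab x - Ker x"
      then show ?thesis using S(4) by blast
    next
      assume "g \<otimes> g \<otimes> g = \<one>"
      then have "(g \<otimes> g) \<otimes> (g \<otimes> g) = g" using g by (simp flip: m_assoc)
      then show ?thesis using g4 False by simp
    next
      assume "g \<otimes> g \<otimes> g \<otimes> g \<otimes> g = \<one>"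
      then have "((g \<otimes> g) \<otimes> (g \<otimes> g)) \<otimes> g = \<one>" using g by (simp add: m_assoc)
      then show ?thesis using g4 False g by simp
    qed
  qed (use g in simp)
  have I_eq: "I = (\<Union>x\<in>Gam. Stab x - Ker x)"
  proof
    show "I \<subseteq> (\<Union>x\<in>Gam. Stab x - Ker x)"
    proof
      fix g assume "g \<in> I"
      then have g: "g \<in> carrier G" "g \<noteq> \<one>" "g \<otimes> g = \<one>" by (auto simp: I_def)
      then have "g \<otimes> g \<otimes> g \<noteq> \<one>" "g \<otimes> g \<otimes> g \<otimes> g \<otimes> g \<noteq> \<one>" by simp_all
      then show "g \<in> (\<Union>x\<in>Gam. Stab x - Ker x)" using cases[OF g(1,2)] by blast
    qed
    show "(\<Union>x\<in>Gam. Stab x - Ker x) \<subseteq> I"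
    proof
      fix g assume "g \<in> (\<Union>x\<in>Gam. Stab x - Ker x)"
      then obtain x where x: "x \<in> Gam" "g \<in> Stab x - Ker x" by blast
      then have "g \<in> carrier G" using stabilizer_subset by blast
      then show "g \<in> I" using S(4)[OF x] x(2) by (auto simp: I_def Ker_eq[OF Gam_E[OF x(1)]])
    qed
  qed
  have I_fix: "\<exists>a\<in>Gam. \<exists>b\<in>Gam. a \<noteq> b \<and> Fix g = {a, b} \<and> card (Stab a \<inter> Stab b) = 2" if "g \<in> I" for g
    using that S(4) unfolding I_eq by blast
  have finI: "finite I" using fin by (simp add: I_def)
  \<comment> \<open>Incidences of involutions and points of \<Gamma>: two points per involution, 6 -
    3 = 3 involutions per point, hence 10 * 3 / 2 = 15 involutions.\<close>
  have "(\<Sum>g\<in>I. \<Sum>x\<in>{x \<in> Gam. x \<in> Fix g}. 1) = (\<Sum>x\<in>Gam. \<Sum>g\<in>{g \<in> I. x \<in> Fix g}. (1::nat))"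
    using finI finGam by (rule sum.swap_restrict)
  moreover have "(\<Sum>x\<in>{x \<in> Gam. x \<in> Fix g}. (1::nat)) = 2" if g: "g \<in> I" for g
  proof -
    obtain a b where ab: "a \<in> Gam" "b \<in> Gam" "a \<noteq> b" "Fix g = {a, b}" using I_fix[OF g] by blast
    then have "{x \<in> Gam. x \<in> Fix g} = {a, b}" by auto
    then show ?thesis using ab(3) by simp
  qed
  moreover have "(\<Sum>g\<in>{g \<in> I. x \<in> Fix g}. (1::nat)) = 3" if x: "x \<in> Gam" for x
  proof -
    have xE: "x \<in> E" using x by (rule Gam_E)
    have "{g \<in> I. x \<in> Fix g} = Stab x - Ker x"
    proof
      show "Stab x - Ker x \<subseteq> {g \<in> I. x \<in> Fix g}"
        using x I_eq Fix_iff[OF xE] stabilizer_subset by blast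
      show "{g \<in> I. x \<in> Fix g} \<subseteq> Stab x - Ker x"
      proof
        fix g assume "g \<in> {g \<in> I. x \<in> Fix g}"
        then have g: "g \<in> I" "x \<in> Fix g" by auto
        then have gG: "g \<in> carrier G" "g \<noteq> \<one>" by (auto simp: I_def)
        have "card (Fix g) = 2" using I_fix[OF g(1)] by force
        then have "Fix g \<noteq> {x}" by auto
        then show "g \<in> Stab x - Ker x" using g(2) gG Fix_iff[OF xE gG(1)] by (simp add: Ker_eq[OF xE])
      qed
    qed
    moreover have "card (Stab x - Ker x) = 3"
      using card_Diff_subset[OF finite_Ker[OF xE] Ker_subset[OF xE]] S(1)[OF x] Ker3[rule_format, OF x] by simp
    ultimately show ?thesis by simp
  qed
  ultimately have "card I * 2 = card Gam * 3" by simp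
  then have "card I = 15" using Gam10 by simp
  moreover have "card {g \<in> carrier G. g \<otimes> t = t \<otimes> g} \<le> 4" if t: "t \<in> I" for t
  proof -
    obtain a b where ab: "a \<noteq> b" "Fix t = {a, b}" "card (Stab a \<inter> Stab b) = 2"
      using I_fix[OF t] by blast
    have "t \<in> carrier G" using t by (simp add: I_def)
    then show ?thesis using card_centralizer_le[OF _ ab(2,1)] ab(3) by simp
  qed
  ultimately show ?thesis
    using order sq_of_pow4 unfolding I_def by (intro iso_alt_group_5)
qed

end

theorem theoremD:
  fixes G :: "('g, 'm) monoid_scheme"
    and \<Omega> :: "'x set"
    and \<phi> :: "'g \<Rightarrow> 'x \<Rightarrow> 'x"
    and \<Gamma> :: "'x set"
    and K :: "'x \<Rightarrow> 'g set"
    and \<gamma> :: 'x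
    and q :: nat
  assumes "group_action G \<Omega> \<phi>"
    and "finite (carrier G)"
    and "\<forall>g \<in> carrier G - {\<one>\<^bsub>G\<^esub>}. card (invariants \<Omega> \<phi> g) \<in> {1, 2}"
    and "\<exists>g \<in> carrier G - {\<one>\<^bsub>G\<^esub>}. card (invariants \<Omega> \<phi> g) = 1"
    and "\<forall>Orb \<in> orbits G \<Omega> \<phi>. 3 \<le> card Orb"
    and "\<Gamma> = unique_fixed_points G \<Omega> \<phi>"
    and "\<forall>\<delta> \<in> \<Gamma>. K \<delta> = one_point_kernel G \<Omega> \<phi> \<delta>"
    and "\<gamma> \<in> \<Gamma>"
    and "q = card (K \<gamma>)"
  shows "\<Gamma> \<in> nonregular_orbits G \<Omega> \<phi> \<and>
    (\<exists>\<Delta>. nonregular_orbits G \<Omega> \<phi> - {\<Gamma>} = {\<Delta>} \<and>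
      ((two_transitive_on G \<phi> \<Gamma> \<and> 3 \<le> q \<and> card \<Gamma> = q + 1 \<and> card \<Delta> = q * (q - 1) \<and>
        (\<forall>\<gamma>' \<in> \<Gamma> - {\<gamma>}.
           real (card (stabilizer G \<phi> \<gamma> \<inter> stabilizer G \<phi> \<gamma>')) = (real q - 1) / 2 \<or>
           real (card (stabilizer G \<phi> \<gamma> \<inter> stabilizer G \<phi> \<gamma>')) = real q - 1))
       \<or>
       (G \<cong> alt_group 5 \<and>
        G\<lparr>carrier := stabilizer G \<phi> \<gamma>\<rparr> \<cong> sym_group 3 \<and>
        subgroup (K \<gamma>) G \<and> G\<lparr>carrier := K \<gamma>\<rparr> \<cong> integer_mod_group 3 \<and>
        q = 3 \<and> card \<Gamma> = 10 \<and> card \<Delta> = 12)))"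
proof -
  interpret A: few_fixed_points G \<Omega> \<phi>
    using assms(1-5) by (simp add: few_fixed_points_def few_fixed_points_axioms_def)
  have \<gamma>: "\<gamma> \<in> A.Gam" using assms(6,8) by simp
  have \<gamma>E: "\<gamma> \<in> \<Omega>" using \<gamma> by (rule A.Gam_E)
  have K: "K \<gamma> = A.Ker \<gamma>" using assms(7,8) by blast
  then have q: "q = card (A.Ker \<gamma>)" using assms(9) by simp
  obtain \<Delta> where \<Delta>: "A.NR - {A.Gam} = {\<Delta>}"
    and card_\<Delta>: "card \<Delta> = card A.Gam * (q - 2) + 2"
    using A.two_nonregular_orbits(3) \<gamma> unfolding q by blast
  obtain y where y: "y \<in> A.Gam" "\<gamma> \<noteq> y" "card (A.suborb \<gamma> y) = q" and q3: "3 \<le> q"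
    and alt: "card A.Gam = q + 1 \<and>
          (card (A.Stab \<gamma> \<inter> A.Stab y) = q - 1 \<or> 2 * card (A.Stab \<gamma> \<inter> A.Stab y) = q - 1)
        \<or> card A.Gam = 10 \<and> q = 3 \<and> card (A.Stab \<gamma> \<inter> A.Stab y) = 2 \<and> (\<forall>z\<in>\<Delta>. card (A.Stab z) = 5)"
    unfolding q by (rule A.obtain_suborbit_in_Gam[OF \<gamma> \<Delta>])
  have yE: "y \<in> \<Omega>" using y(1) by (rule A.Gam_E)
  have finGam: "finite A.Gam" using A.finite_orb[of \<gamma>] A.two_nonregular_orbits(1)[OF \<gamma>] by simp
  let ?b = "G \<cong> alt_group 5 \<and> G\<lparr>carrier := A.Stab \<gamma>\<rparr> \<cong> sym_group 3 \<and>
        subgroup (K \<gamma>) G \<and> G\<lparr>carrier := K \<gamma>\<rparr> \<cong> integer_mod_group 3 \<and>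
        q = 3 \<and> card A.Gam = 10 \<and> card \<Delta> = 12"
  let ?a = "two_transitive_on G \<phi> A.Gam \<and> 3 \<le> q \<and> card A.Gam = q + 1 \<and> card \<Delta> = q * (q - 1) \<and>
        (\<forall>\<gamma>' \<in> A.Gam - {\<gamma>}.
           real (card (A.Stab \<gamma> \<inter> A.Stab \<gamma>')) = (real q - 1) / 2 \<or>
           real (card (A.Stab \<gamma> \<inter> A.Stab \<gamma>')) = real q - 1)"
  have "?a \<or> ?b"
    using alt
  proof
    assume a: "card A.Gam = q + 1 \<and>
      (card (A.Stab \<gamma> \<inter> A.Stab y) = q - 1 \<or> 2 * card (A.Stab \<gamma> \<inter> A.Stab y) = q - 1)"
    have sub: "A.suborb \<gamma> y \<subseteq> A.Gam - {\<gamma>}"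
      using A.suborb_subset_orb[of \<gamma> y] A.two_nonregular_orbits(1)[OF y(1)]
        A.suborb_not_self[OF \<gamma>E yE y(2)] by blast
    \<comment> \<open>The suborbit has q = |\<Gamma>| - 1 elements, so it exhausts the rest of
      \<Gamma>.\<close>
    have "A.suborb \<gamma> y = A.Gam - {\<gamma>}"
      using a y(3) \<gamma> finGam by (intro card_subset_eq[OF _ sub]) auto
    then have eq: "A.Gam - {\<gamma>} = A.suborb \<gamma> y" by simp
    have "two_transitive_on G \<phi> A.Gam"
      using A.two_transitive_Gam[OF \<gamma> _ yE] eq by simp
    moreover have "card \<Delta> = q * (q - 1)"
    proof -
      \<comment> \<open>Turns (q + 1)(q - 2) + 2 = q(q - 1) into an identity free of truncated
        subtraction.\<close>
      obtain r where "q = r + 2" using q3 that[of "q - 2"] by simp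
      then show ?thesis using card_\<Delta> a by simp
    qed
    moreover have "real (card (A.Stab \<gamma> \<inter> A.Stab z)) = (real q - 1) / 2 \<or>
        real (card (A.Stab \<gamma> \<inter> A.Stab z)) = real q - 1" if z: "z \<in> A.Gam - {\<gamma>}" for z
    proof -
      have zE: "z \<in> \<Omega>" using z A.Gam_E by blast
      have "A.suborb \<gamma> z = A.suborb \<gamma> y" using A.suborb_eq[OF \<gamma>E yE] z eq by blast
      then have "q * card (A.Stab \<gamma> \<inter> A.Stab z) = q * card (A.Stab \<gamma> \<inter> A.Stab y)"
        using A.card_suborb[OF \<gamma>E zE] A.card_suborb[OF \<gamma>E yE] y(3) by simp
      then have "card (A.Stab \<gamma> \<inter> A.Stab z) = card (A.Stab \<gamma> \<inter> A.Stab y)" using q3 by simp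
      then have "card (A.Stab \<gamma> \<inter> A.Stab z) = q - 1 \<or> 2 * card (A.Stab \<gamma> \<inter> A.Stab z) = q - 1"
        using a by simp
      then have "real (card (A.Stab \<gamma> \<inter> A.Stab z)) = real q - 1 \<or>
          2 * real (card (A.Stab \<gamma> \<inter> A.Stab z)) = real q - 1"
        using q3 by linarith
      then show ?thesis by auto
    qed
    ultimately show ?thesis using a q3 by blast
  next
    assume b: "card A.Gam = 10 \<and> q = 3 \<and> card (A.Stab \<gamma> \<inter> A.Stab y) = 2 \<and> (\<forall>z\<in>\<Delta>. card (A.Stab z) = 5)"
    \<comment> \<open>The value q = 3 at \<gamma> spreads over \<Gamma> by transitivity.\<close>
    have Ker3: "\<forall>x\<in>A.Gam. card (A.Ker x) = 3"
      using A.card_Ker_orb[OF \<gamma>E] A.two_nonregular_orbits(1)[OF \<gamma>] b q by simp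
    have Gam10: "card A.Gam = 10" using b by simp
    note S = A.exceptional_point_stabilizer[OF \<Delta> Gam10 Ker3 \<gamma>]
    have sub: "subgroup (K \<gamma>) G"
      unfolding K using A.Ker_subgroup_order_3[OF \<gamma>E S(1) Ker3[rule_format, OF \<gamma>]] S(4) by blast
    then interpret H: group "G\<lparr>carrier := K \<gamma>\<rparr>" using A.subgroup_imp_group by blast
    have "order (G\<lparr>carrier := K \<gamma>\<rparr>) = 3" using Ker3[rule_format, OF \<gamma>] by (simp add: order_def K)
    then have "G\<lparr>carrier := K \<gamma>\<rparr> \<cong> integer_mod_group 3"
      using H.prime_order_iso_integer_mod_group by simp
    moreover have "G\<lparr>carrier := A.Stab \<gamma>\<rparr> \<cong> sym_group 3"
      using A.Stab_iso_sym_group_3[OF \<gamma>E yE y(2) _ S(1)] y(3) b by simp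
    moreover have "G \<cong> alt_group 5" by (rule A.exceptional_iso_alt_group_5[OF \<Delta> Gam10 Ker3])
    ultimately show ?thesis using sub b card_\<Delta> by simp
  qed
  then show ?thesis
    using A.two_nonregular_orbits(2) \<Delta> unfolding assms(6) by blast
qed

end
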